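(* Let $(Y,X)=(Y,X_1,\dots,X_d)\sim$ Pareto-Dirichlet$(\beta)$, $\beta=(\beta_0,\beta_1,\dots,\beta_d)\in(0,\infty)^{d+1}$, $d\ge1$. Then: (i) $h^{(\mathrm{opt})}(X):=c\|X\|_1$ is an asymptotically calibrated and optimal homogeneous predictor for $Y$, where $c:=\beta_0/\sum_{i=1}^d\beta_i$. (ii) The optimal asymptotic precision is given by $$\lambda^{(\mathrm{opt})}_{\mathcal G}(Y,X)=\lambda(Y,h^{(\mathrm{opt})}(X))=\mathbb E\Big[\frac{U}{\mu_U}\wedge\frac{1-U}{1-\mu_U}\Big],$$ where $U\sim\mathrm{Beta}(\beta_0,\sum_{i=1}^d\beta_i)$ and $\mu_U=\mathbb E[U]=\beta_0/\sum_{i=0}^d\beta_i$. (iii) Moreover, $$\lambda^{(\mathrm{opt})}_{\mathcal G}(Y,X)=\lambda_p(Y,h^{(\mathrm{opt})}(X))\quad\text{for all }p\in(p_0,1),$$ where $p_0=(1\vee c)/(c+1)=\mu_U\vee(1-\mu_U)$.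
   Context: $(Y,X)\sim$ Pareto-Dirichlet$(\beta)$ means $(Y,X)=\xi\cdot(V,W)$, where $\xi$ is standard $1$-Pareto ($\mathbb P[\xi>x]=1/x$, $x\ge1$), independent of the non-negative vector $(V,W)=(V,W_1,\dots,W_d)\sim\mathrm{Dirichlet}(\beta)$, i.e. $V+\sum_{i=1}^dW_i=1$ and $(W_1,\dots,W_d)$ has density $\frac{\Gamma(\sum_{i=0}^d\beta_i)}{\prod_{i=0}^d\Gamma(\beta_i)}(1-\sum_{i=1}^dx_i)^{\beta_0-1}\prod_{i=1}^dx_i^{\beta_i-1}$ on $\{x_i\ge0,\ \sum x_i\le1\}$. Here $\tau(y,x)=|y|+\|x\|_1$ and $\tau_X(x)=\|x\|_1$. For a function $h$, $\lambda_p(Y,h(X))=\mathbb P[Y>F_Y^\leftarrow(p)\mid h(X)>F_{h(X)}^\leftarrow(p)]$ ($F^\leftarrow$ the left-continuous generalized inverse of the cdf), and $\lambda(Y,h(X))=\lim_{p\uparrow1}\lambda_p(Y,h(X))$ when the limit exists. $h(X)$ is asymptotically calibrated for $Y$ if $\mathbb P[h(X)>t]\sim\mathbb P[Y>t]$ as $t\to\infty$. $\mathcal G$ is the class of continuous, non-negative, $1$-homogeneous functions $g:\mathbb R^d\to[0,\infty)$ ($g(cx)=cg(x)$, $c\ge0$) that are asymptotically calibrated for $Y$ (with $\{g>0\}\subset\{\tau_X>0\}$ and $g$ bounded on $\{\tau_X=1\}$, which are automatic here). $\lambda^{(\mathrm{opt})}_{\mathcal G}(Y,X)=\sup_{g\in\mathcal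 G}\limsup_{p\uparrow1}\lambda_p(Y,g(X))$, and $h\in\mathcal G$ is optimal if $\lambda(Y,h(X))$ exists and equals $\lambda_{\mathcal G}^{(\mathrm{opt})}(Y,X)$. *)

theory Defs
  imports "HOL-Probability.Probability" "HOL-Library.Landau_Symbols"
begin

section \<open>Pareto-Dirichlet vectors\<close>

text \<open>The parameter vector \<open>(\<beta>\<^sub>0, \<beta>\<^sub>1, \<dots>, \<beta>\<^sub>d)\<close> is given as a pair of the number \<open>\<beta>\<^sub>0\<close> and the
  vector \<open>\<beta>\<close> of the remaining entries; the dimension \<open>d\<close> is the cardinality of the finite
  type \<open>'n\<close>.\<close>

definition standard_pareto :: "'w measure \<Rightarrow> ('w \<Rightarrow> real) \<Rightarrow> bool" where
  "standard_pareto M \<xi> \<longleftrightarrow> \<xi> \<in> borel_measurable M \<and> (\<forall>x\<ge>1. \<P>(\<omega> in M. \<xi> \<omega> > x) = 1 / x)"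

text \<open>Since \<open>0 powr a = 0\<close> for all \<open>a\<close>, the density below is \<open>0\<close> on the boundary of the simplex,
  which is a null set.\<close>

definition dirichlet_density :: "real \<Rightarrow> real ^ 'n \<Rightarrow> real ^ 'n \<Rightarrow> real" where
  "dirichlet_density \<beta>\<^sub>0 \<beta> x =
     (if (\<forall>i. 0 \<le> x $ i) \<and> (\<Sum>i\<in>UNIV. x $ i) \<le> 1
      then Gamma (\<beta>\<^sub>0 + (\<Sum>i\<in>UNIV. \<beta> $ i)) / (Gamma \<beta>\<^sub>0 * (\<Prod>i\<in>UNIV. Gamma (\<beta> $ i)))
           * (1 - (\<Sum>i\<in>UNIV. x $ i)) powr (\<beta>\<^sub>0 - 1) * (\<Prod>i\<in>UNIV. (x $ i) powr (\<beta> $ i - 1))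
      else 0)"

definition dirichlet ::
  "'w measure \<Rightarrow> real \<Rightarrow> real ^ 'n \<Rightarrow> ('w \<Rightarrow> real) \<Rightarrow> ('w \<Rightarrow> real ^ 'n) \<Rightarrow> bool" where
  "dirichlet M \<beta>\<^sub>0 \<beta> V W \<longleftrightarrow>
     V \<in> borel_measurable M \<and>
     distributed M lborel W (\<lambda>x. ennreal (dirichlet_density \<beta>\<^sub>0 \<beta> x)) \<and>
     (AE \<omega> in M. V \<omega> + (\<Sum>i\<in>UNIV. W \<omega> $ i) = 1)"

text \<open>Requiring \<open>\<xi>\<close>, \<open>V\<close>, \<open>W\<close> to live on the same space as \<open>Y\<close>, \<open>X\<close> makes this no stronger than a
  condition on the law of \<open>(Y, X)\<close>: almost surely \<open>\<xi>\<close> equals the sum of all entries of \<open>(Y, X)\<close>,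
  so that \<open>\<xi>\<close>, \<open>V\<close> and \<open>W\<close> can be recovered from \<open>(Y, X)\<close>. Independence of \<open>\<xi>\<close> and \<open>(V, W)\<close> is
  stated through the generated sigma-algebras because \<open>indep_var\<close> requires both random variables
  to take values in the same type.\<close>

definition pareto_dirichlet ::
  "'w measure \<Rightarrow> real \<Rightarrow> real ^ 'n \<Rightarrow> ('w \<Rightarrow> real) \<Rightarrow> ('w \<Rightarrow> real ^ 'n) \<Rightarrow> bool" where
  "pareto_dirichlet M \<beta>\<^sub>0 \<beta> Y X \<longleftrightarrow>
     Y \<in> borel_measurable M \<and> X \<in> borel_measurable M \<and>
     (\<exists>\<xi> V W. standard_pareto M \<xi> \<and> dirichlet M \<beta>\<^sub>0 \<beta> V W \<and>
        prob_space.indep_set M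
          {\<xi> -` A \<inter> space M | A. A \<in> sets borel}
          {(\<lambda>\<omega>. (V \<omega>, W \<omega>)) -` B \<inter> space M | B. B \<in> sets borel} \<and>
        (AE \<omega> in M. Y \<omega> = \<xi> \<omega> * V \<omega> \<and> X \<omega> = \<xi> \<omega> *\<^sub>R W \<omega>))"

definition beta_density :: "real \<Rightarrow> real \<Rightarrow> real \<Rightarrow> real" where
  "beta_density a b u =
     (if 0 \<le> u \<and> u \<le> 1 then u powr (a - 1) * (1 - u) powr (b - 1) / Beta a b else 0)"

definition beta_law :: "real \<Rightarrow> real \<Rightarrow> real measure" where
  "beta_law a b = density lborel (\<lambda>u. ennreal (beta_density a b u))"

section \<open>Asymptotic precision\<close>

definition quantile :: "'w measure \<Rightarrow> ('w \<Rightarrow> real) \<Rightarrow> real \<Rightarrow> real" where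
  "quantile M Z p = Inf {x. p \<le> cdf (distr M borel Z) x}"

definition precision :: "'w measure \<Rightarrow> ('w \<Rightarrow> real) \<Rightarrow> ('w \<Rightarrow> real) \<Rightarrow> real \<Rightarrow> real" where
  "precision M Y Z p = cond_prob M (\<lambda>\<omega>. Y \<omega> > quantile M Y p) (\<lambda>\<omega>. Z \<omega> > quantile M Z p)"

definition asymp_precision_exists :: "'w measure \<Rightarrow> ('w \<Rightarrow> real) \<Rightarrow> ('w \<Rightarrow> real) \<Rightarrow> bool" where
  "asymp_precision_exists M Y Z \<longleftrightarrow> (\<exists>l. (precision M Y Z \<longlongrightarrow> l) (at_left 1))"

text \<open>Only meaningful if the limit exists.\<close>

definition asymp_precision :: "'w measure \<Rightarrow> ('w \<Rightarrow> real) \<Rightarrow> ('w \<Rightarrow> real) \<Rightarrow> real" where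
  "asymp_precision M Y Z = Lim (at_left 1) (precision M Y Z)"

definition asymp_calibrated :: "'w measure \<Rightarrow> ('w \<Rightarrow> real) \<Rightarrow> ('w \<Rightarrow> real) \<Rightarrow> bool" where
  "asymp_calibrated M Y Z \<longleftrightarrow> (\<lambda>t. \<P>(\<omega> in M. Z \<omega> > t)) \<sim>[at_top] (\<lambda>t. \<P>(\<omega> in M. Y \<omega> > t))"

definition l1_norm :: "real ^ 'n \<Rightarrow> real" where
  "l1_norm x = (\<Sum>i\<in>UNIV. \<bar>x $ i\<bar>)"

text \<open>The last two conditions follow from the preceding ones; they matter only for more general
  functionals in place of the 1-norm.\<close>

definition homogeneous_predictors ::
  "'w measure \<Rightarrow> ('w \<Rightarrow> real) \<Rightarrow> ('w \<Rightarrow> real ^ 'n) \<Rightarrow> (real ^ 'n \<Rightarrow> real) set" where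
  "homogeneous_predictors M Y X =
     {g. continuous_on UNIV g \<and> (\<forall>x. 0 \<le> g x) \<and> (\<forall>c\<ge>0. \<forall>x. g (c *\<^sub>R x) = c * g x) \<and>
         asymp_calibrated M Y (\<lambda>\<omega>. g (X \<omega>)) \<and>
         {x. g x > 0} \<subseteq> {x. l1_norm x > 0} \<and> bounded (g ` {x. l1_norm x = 1})}"

definition opt_precision :: "'w measure \<Rightarrow> ('w \<Rightarrow> real) \<Rightarrow> ('w \<Rightarrow> real ^ 'n) \<Rightarrow> ereal" where
  "opt_precision M Y X =
     (SUP g\<in>homogeneous_predictors M Y X.
        Limsup (at_left 1) (\<lambda>p. ereal (precision M Y (\<lambda>\<omega>. g (X \<omega>)) p)))"

definition optimal_predictor ::
  "'w measure \<Rightarrow> ('w \<Rightarrow> real) \<Rightarrow> ('w \<Rightarrow> real ^ 'n) \<Rightarrow> (real ^ 'n \<Rightarrow> real) \<Rightarrow> bool" where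
  "optimal_predictor M Y X h \<longleftrightarrow>
     h \<in> homogeneous_predictors M Y X \<and>
     asymp_precision_exists M Y (\<lambda>\<omega>. h (X \<omega>)) \<and>
     ereal (asymp_precision M Y (\<lambda>\<omega>. h (X \<omega>))) = opt_precision M Y X"

end

theory Submission imports Defs begin

text \<open>Let \<open>S = \<parallel>W\<parallel>\<^sub>1 = 1 - V\<close>. Since \<open>\<xi>\<close> is standard Pareto and independent of \<open>(V, W)\<close>, all tails are
  exactly of the form \<open>const / t\<close> for large \<open>t\<close>. Hence calibration of \<open>g\<close> means \<open>E g(W) = E V\<close>, and the
  precision of a calibrated \<open>g\<close> equals \<open>E [V \<and> g(W)] / E V\<close> for all \<open>p\<close> near \<open>1\<close>.

  The Dirichlet density is a homogeneous function times a function of \<open>S\<close>. Scaling Lebesgue measure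
  shows that a homogeneous function integrated over \<open>{S \<le> s}\<close> is a multiple of a power of \<open>s\<close>; this
  yields the Beta law of \<open>S\<close> without evaluating Dirichlet integrals, and \<open>E [\<phi>(S) g(W)]\<close>
  proportional to \<open>E [\<phi>(S) S]\<close> for \<open>1\<close>-homogeneous \<open>g\<close>. With the latter identity, the supporting
  line of \<open>x \<mapsto> v \<and> x\<close> at \<open>c S\<close> bounds \<open>E [V \<and> g(W)]\<close> by its value for \<open>g = c \<parallel>\<cdot>\<parallel>\<^sub>1\<close>.\<close>

section \<open>Homogeneous densities and the 1-norm\<close>

lemma l1_norm_nonneg [simp]: "0 \<le> l1_norm x"
  unfolding l1_norm_def by (simp add: sum_nonneg)

lemma l1_norm_scaleR: "l1_norm (c *\<^sub>R x) = \<bar>c\<bar> * l1_norm x"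
  unfolding l1_norm_def by (simp add: abs_mult sum_distrib_left)

lemma l1_norm_eq_0_iff [simp]: "l1_norm x = 0 \<longleftrightarrow> x = 0"
  unfolding l1_norm_def by (auto simp: sum_nonneg_eq_0_iff vec_eq_iff)

lemma l1_norm_zero [simp]: "l1_norm 0 = 0"
  by simp

lemma l1_norm_pos_iff [simp]: "0 < l1_norm x \<longleftrightarrow> x \<noteq> 0"
  using l1_norm_nonneg[of x] by (simp add: less_le)

lemma continuous_on_l1_norm: "continuous_on A l1_norm"
  unfolding l1_norm_def by (intro continuous_intros)

lemma borel_measurable_l1_norm [measurable]: "l1_norm \<in> borel_measurable borel"
  by (intro borel_measurable_continuous_onI continuous_on_l1_norm)

section \<open>Dilations of Lebesgue measure and radial integration\<close>

lemma nn_integral_lborel_scaleR: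
  fixes f :: "'a::euclidean_space \<Rightarrow> ennreal"
  assumes [measurable]: "f \<in> borel_measurable borel" and c: "c > 0"
  shows "(\<integral>\<^sup>+x. f x \<partial>lborel) = ennreal (c ^ DIM('a)) * (\<integral>\<^sup>+x. f (c *\<^sub>R x) \<partial>lborel)"
  using c by (subst lborel_affine[of c 0])
    (simp_all add: nn_integral_density nn_integral_distr nn_integral_cmult)

text \<open>Dilation by \<open>t\<close> maps the unit ball of the 1-norm onto the ball of radius
  \<open>t\<close>. Homogeneity contributes \<open>t powr r\<close>, the Jacobian contributes
  \<open>t ^ CARD('n)\<close>. In \<open>ennreal\<close> the identity also covers infinite
  integrals.\<close>

lemma nn_integral_l1_norm_ball:
  fixes G :: "real ^ 'n \<Rightarrow> ennreal"
  assumes [measurable]: "G \<in> borel_measurable borel"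
    and hom: "\<And>c x. 0 < c \<Longrightarrow> G (c *\<^sub>R x) = ennreal (c powr r) * G x"
    and t: "t > 0"
  shows "(\<integral>\<^sup>+x. G x * indicator {..t} (l1_norm x) \<partial>lborel) =
    ennreal (t powr (r + CARD('n))) * (\<integral>\<^sup>+x. G x * indicator {..1} (l1_norm x) \<partial>lborel)"
proof -
  have "(\<integral>\<^sup>+x. G x * indicator {..t} (l1_norm x) \<partial>lborel) =
    ennreal (t ^ CARD('n)) * (\<integral>\<^sup>+x. G (t *\<^sub>R x) * indicator {..t} (l1_norm (t *\<^sub>R x)) \<partial>lborel)"
    using nn_integral_lborel_scaleR[of "\<lambda>x. G x * indicator {..t} (l1_norm x)" t] t by simp
  also have "(\<integral>\<^sup>+x. G (t *\<^sub>R x) * indicator {..t} (l1_norm (t *\<^sub>R x)) \<partial>lborel) =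
    (\<integral>\<^sup>+x. ennreal (t powr r) * (G x * indicator {..1} (l1_norm x)) \<partial>lborel)"
    using t by (intro nn_integral_cong)
      (auto simp: hom l1_norm_scaleR indicator_def mult_le_cancel_left1 split: if_splits)
  also have "\<dots> = ennreal (t powr r) * (\<integral>\<^sup>+x. G x * indicator {..1} (l1_norm x) \<partial>lborel)"
    by (intro nn_integral_cmult) simp
  finally show ?thesis
    using t by (simp add: powr_add powr_realpow ennreal_mult mult_ac)
qed

text \<open>A substitute for polar coordinates: the mass that \<open>G\<close> gives to the ball of
  radius \<open>t \<le> 1\<close> is proportional to \<open>t powr a\<close>, so the image of this
  mass under the 1-norm has density proportional to \<open>a * s powr (a - 1)\<close>. Finiteness of
  the mass allows the comparison of distribution functions.\<close>

lemma nn_integral_radial: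
  fixes G :: "real ^ 'n \<Rightarrow> ennreal" and r a :: real
  assumes [measurable]: "G \<in> borel_measurable borel"
    and hom: "\<And>c x. 0 < c \<Longrightarrow> G (c *\<^sub>R x) = ennreal (c powr r) * G x"
    and a: "a = r + CARD('n)" "a > 0"
    and fin: "(\<integral>\<^sup>+x. G x * indicator {..1} (l1_norm x) \<partial>lborel) < \<infinity>"
    and f [measurable]: "f \<in> borel_measurable borel"
  shows "(\<integral>\<^sup>+x. f (l1_norm x) * (G x * indicator {..1} (l1_norm x)) \<partial>lborel) =
    (\<integral>\<^sup>+x. G x * indicator {..1} (l1_norm x) \<partial>lborel) *
    (\<integral>\<^sup>+s. f s * ennreal (a * s powr (a - 1)) * indicator {0..1} s \<partial>lborel)"
proof -
  define K where "K = (\<integral>\<^sup>+x. G x * indicator {..1} (l1_norm x) \<partial>lborel)"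
  \<comment> \<open>\<open>N1\<close> is the law of the 1-norm under \<open>G\<close> on the unit
    ball, \<open>N2\<close> the claimed radial law. Both are finite, so agreement on all half-lines
    identifies them.\<close>
  define N1 where "N1 = distr (density lborel (\<lambda>x. G x * indicator {..1} (l1_norm x))) borel l1_norm"
  define N2 where "N2 = density lborel (\<lambda>s. K * (ennreal (a * s powr (a - 1)) * indicator {0..1} s))"
  have sets [simp]: "sets N1 = sets borel" "sets N2 = sets borel"
    by (simp_all add: N1_def N2_def)
  have pow: "(\<integral>\<^sup>+s. ennreal (a * s powr (a - 1)) * indicator {0..t} s \<partial>lborel) = ennreal (t powr a)"
    if "t \<ge> 0" for t
  proof -
    have "((\<lambda>s. a * s powr (a - 1)) has_integral a * (t powr (a - 1 + 1) / (a - 1 + 1))) {0..t}"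
      using a that by (intro has_integral_mult_right has_integral_powr_from_0) auto
    then show ?thesis
      using a that by (subst nn_integral_has_integral_lebesgue') auto
  qed
  have 1: "emeasure N1 {..t} = (\<integral>\<^sup>+x. G x * indicator {..min 1 t} (l1_norm x) \<partial>lborel)" for t
    unfolding N1_def
    by (subst emeasure_distr, simp, simp, subst emeasure_density)
      (auto intro!: nn_integral_cong measurable_sets_borel[OF borel_measurable_l1_norm]
        simp: indicator_def)
  have 2: "emeasure N2 {..t} =
    (\<integral>\<^sup>+s. K * (ennreal (a * s powr (a - 1)) * indicator {0..min 1 t} s) \<partial>lborel)" for t
    unfolding N2_def
    by (subst emeasure_density) (auto intro!: nn_integral_cong simp: indicator_def)
  have eq: "emeasure N1 {..t} = emeasure N2 {..t}" for t
  proof (cases t "0::real" rule: linorder_cases)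
    case less
    have "\<not> l1_norm x \<le> t" for x :: "real ^ 'n"
      using less l1_norm_nonneg[of x] by linarith
    then show ?thesis using less unfolding 1 2 by (simp add: min_def)
  next
    case equal
    \<comment> \<open>The scaling identity requires a positive radius; at radius 0 the ball is a
      single point, hence a null set.\<close>
    have "AE x in lborel. x \<noteq> (0 :: real ^ 'n)"
      by (rule AE_lborel_singleton)
    moreover have "l1_norm x \<le> 0 \<longleftrightarrow> x = 0" for x :: "real ^ 'n"
      using l1_norm_nonneg[of x] l1_norm_eq_0_iff[of x] by linarith
    ultimately have "(\<integral>\<^sup>+x. G x * indicator {..0} (l1_norm x) \<partial>lborel) = 0"
      by (subst nn_integral_0_iff_AE) (auto simp: indicator_def)
    then show ?thesis using equal pow[of 0] unfolding 1 2
      by (subst nn_integral_cmult) (auto simp: min_def)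
  next
    case greater
    \<comment> \<open>Both laws are cut off at 1, so the relevant radius is
      \<open>min 1 t\<close>.\<close>
    then have "min 1 t > 0" by simp
    from nn_integral_l1_norm_ball[OF assms(1) hom this]
    have "emeasure N1 {..t} = ennreal (min 1 t powr a) * K"
      unfolding 1 a(1) K_def .
    also have "\<dots> = emeasure N2 {..t}"
      using greater pow[of "min 1 t"] unfolding 2
      by (subst nn_integral_cmult) (auto simp: mult.commute)
    finally show ?thesis .
  qed
  have UN: "emeasure N1 UNIV < \<infinity>" "emeasure N2 UNIV < \<infinity>"
  proof -
    show "emeasure N1 UNIV < \<infinity>"
      unfolding N1_def using fin by (subst emeasure_distr) (auto simp: emeasure_density)
    have "emeasure N2 UNIV = K * 1"
      unfolding N2_def using pow[of 1]
      by (subst emeasure_density) (auto simp: nn_integral_cmult)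
    then show "emeasure N2 UNIV < \<infinity>" using fin by (simp add: K_def)
  qed
  have "N1 = N2"
  proof (rule cdf_unique')
    show "finite_borel_measure N1" "finite_borel_measure N2"
      using UN sets_eq_imp_space_eq[OF sets(1)] sets_eq_imp_space_eq[OF sets(2)]
      by (auto intro!: finite_borel_measure.intro finite_measureI
        simp: finite_borel_measure_axioms_def)
    show "cdf N1 = cdf N2"
      using eq by (auto simp: cdf_def measure_def fun_eq_iff)
  qed
  have "(\<integral>\<^sup>+x. f (l1_norm x) * (G x * indicator {..1} (l1_norm x)) \<partial>lborel) = (\<integral>\<^sup>+s. f s \<partial>N1)"
    unfolding N1_def by (subst nn_integral_distr, simp, simp, subst nn_integral_density)
      (auto simp: mult_ac)
  also have "\<dots> = (\<integral>\<^sup>+s. f s \<partial>N2)" using \<open>N1 = N2\<close> by simp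
  also have "\<dots> = (\<integral>\<^sup>+s. K * (f s * ennreal (a * s powr (a - 1)) * indicator {0..1} s) \<partial>lborel)"
    unfolding N2_def by (subst nn_integral_density) (auto intro!: nn_integral_cong simp: mult_ac)
  also have "\<dots> = K * (\<integral>\<^sup>+s. f s * ennreal (a * s powr (a - 1)) * indicator {0..1} s \<partial>lborel)"
    by (intro nn_integral_cmult) simp
  finally show ?thesis unfolding K_def .
qed

section \<open>Dirichlet and Beta laws\<close>

lemma Beta_pos_real: "a > 0 \<Longrightarrow> b > 0 \<Longrightarrow> Beta a b > (0 :: real)"
  by (simp add: Beta_def)

lemma nn_integral_Beta:
  fixes a b :: real
  assumes "a > 0" "b > 0"
  shows "(\<integral>\<^sup>+s. ennreal (s powr (a - 1) * (1 - s) powr (b - 1)) * indicator {0..1} s \<partial>lborel) =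
    ennreal (Beta a b)"
  using has_integral_Beta_real[OF assms] by (intro nn_integral_has_integral_lebesgue') auto

lemma borel_measurable_beta_density [measurable]: "beta_density a b \<in> borel_measurable borel"
  unfolding beta_density_def by measurable

section \<open>Homogeneous integrands under the Dirichlet law\<close>

lemma l1_norm_of_nonneg: "(\<And>i. 0 \<le> x $ i) \<Longrightarrow> l1_norm x = (\<Sum>i\<in>UNIV. x $ i)"
  unfolding l1_norm_def by simp

text \<open>On the orthant the sum of the coordinates is the 1-norm. The density thus separates into
  a function of the 1-norm and a monomial, which is homogeneous of degree
  \<open>(\<Sum>i\<in>UNIV. \<beta> $ i) - CARD('n)\<close>.\<close>

lemma dirichlet_density_factor:
  fixes x :: "real ^ 'n"
  assumes C: "C = Gamma (\<beta>\<^sub>0 + (\<Sum>i\<in>UNIV. \<beta> $ i)) / (Gamma \<beta>\<^sub>0 * (\<Prod>i\<in>UNIV. Gamma (\<beta> $ i)))"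
  shows "dirichlet_density \<beta>\<^sub>0 \<beta> x = C * (1 - l1_norm x) powr (\<beta>\<^sub>0 - 1) *
    (if \<forall>i. 0 \<le> x $ i then \<Prod>i\<in>UNIV. (x $ i) powr (\<beta> $ i - 1) else 0) *
    indicator {..1} (l1_norm x)"
  by (auto simp: dirichlet_density_def l1_norm_of_nonneg C)

text \<open>The monomial part of the density times \<open>g\<close> is homogeneous, so radial
  integration applies; the remaining factor depends on the 1-norm only and joins
  \<open>\<phi>\<close>. One constant \<open>K\<close> serves every \<open>\<phi>\<close>, so that
  it can later be found by normalization or cancelled.\<close>

lemma nn_integral_dirichlet_homogeneous:
  fixes W :: "'w \<Rightarrow> real ^ 'n" and g :: "real ^ 'n \<Rightarrow> real"
  assumes W: "distributed M lborel W (\<lambda>x. ennreal (dirichlet_density \<beta>\<^sub>0 \<beta> x))"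
    and pos: "\<beta>\<^sub>0 > 0" "\<And>i. \<beta> $ i > 0"
    and g [measurable]: "g \<in> borel_measurable borel" and g0: "\<And>x. g x \<ge> 0"
    and hom: "\<And>c x. c > 0 \<Longrightarrow> g (c *\<^sub>R x) = c powr k * g x" and k: "k \<ge> 0"
    and fin: "(\<integral>\<^sup>+\<omega>. ennreal (g (W \<omega>)) \<partial>M) < \<infinity>"
  shows "\<exists>K. \<forall>\<phi> \<in> borel_measurable (borel :: real measure).
      (\<integral>\<^sup>+\<omega>. \<phi> (l1_norm (W \<omega>)) * ennreal (g (W \<omega>)) \<partial>M) =
      K * (\<integral>\<^sup>+s. \<phi> s * ennreal (s powr ((\<Sum>i\<in>UNIV. \<beta> $ i) + k - 1) * (1 - s) powr (\<beta>\<^sub>0 - 1)) *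
        indicator {0..1} s \<partial>lborel)"
proof -
  define b where "b = (\<Sum>i\<in>UNIV. \<beta> $ i)"
  define C where "C = Gamma (\<beta>\<^sub>0 + b) / (Gamma \<beta>\<^sub>0 * (\<Prod>i\<in>UNIV. Gamma (\<beta> $ i)))"
  have b: "b > 0"
    unfolding b_def using pos by (intro sum_pos) auto
  have C: "C > 0"
    unfolding C_def using pos b by (intro divide_pos_pos mult_pos_pos prod_pos) auto
  define P where "P = (\<lambda>x::real^'n. if \<forall>i. 0 \<le> x $ i then \<Prod>i\<in>UNIV. (x $ i) powr (\<beta> $ i - 1) else 0)"
  have P0: "P x \<ge> 0" for x
    unfolding P_def by (auto intro: prod_nonneg)
  have P [measurable]: "P \<in> borel_measurable borel"
    unfolding P_def by measurable
  have Phom: "P (c *\<^sub>R x) = c powr (b - CARD('n)) * P x" if "c > 0" for c x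
  proof -
    have "(\<Prod>i\<in>UNIV. (c * x $ i) powr (\<beta> $ i - 1)) =
        c powr (b - CARD('n)) * (\<Prod>i\<in>UNIV. (x $ i) powr (\<beta> $ i - 1))" if "\<forall>i. 0 \<le> x $ i"
    proof -
      have "(\<Prod>i\<in>UNIV. (c * x $ i) powr (\<beta> $ i - 1)) =
          (\<Prod>i\<in>UNIV. c powr (\<beta> $ i - 1)) * (\<Prod>i\<in>UNIV. (x $ i) powr (\<beta> $ i - 1))"
        using \<open>c > 0\<close> that by (simp add: powr_mult prod.distrib)
      also have "(\<Prod>i\<in>UNIV. c powr (\<beta> $ i - 1)) = c powr (b - CARD('n))"
        using \<open>c > 0\<close> by (simp add: powr_sum[symmetric] b_def sum_subtractf)
      finally show ?thesis .
    qed
    then show ?thesis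
      using that by (auto simp: P_def zero_le_mult_iff)
  qed
  define D where "D = dirichlet_density \<beta>\<^sub>0 \<beta>"
  have D: "D x = C * (1 - l1_norm x) powr (\<beta>\<^sub>0 - 1) * P x * indicator {..1} (l1_norm x)" for x
    unfolding D_def P_def by (rule dirichlet_density_factor) (simp add: C_def b_def)
  have W': "distributed M lborel W (\<lambda>x. ennreal (D x))"
    using W unfolding D_def .
  define G where "G = (\<lambda>x. ennreal (g x * P x))"
  have G [measurable]: "G \<in> borel_measurable borel"
    unfolding G_def by measurable
  define r where "r = b + k - CARD('n)"
  have Ghom: "G (c *\<^sub>R x) = ennreal (c powr r) * G x" if "c > 0" for c x
  proof -
    have "g (c *\<^sub>R x) * P (c *\<^sub>R x) = c powr r * (g x * P x)"
      using that by (simp add: hom Phom r_def powr_add powr_diff)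
    then show ?thesis
      unfolding G_def by (simp add: ennreal_mult')
  qed
  have EW: "(\<integral>\<^sup>+\<omega>. \<phi> (l1_norm (W \<omega>)) * ennreal (g (W \<omega>)) \<partial>M) =
      (\<integral>\<^sup>+x. \<phi> (l1_norm x) * ennreal (C * (1 - l1_norm x) powr (\<beta>\<^sub>0 - 1)) *
        (G x * indicator {..1} (l1_norm x)) \<partial>lborel)"
    if [measurable]: "\<phi> \<in> borel_measurable borel" for \<phi> :: "real \<Rightarrow> ennreal"
  proof -
    have "(\<integral>\<^sup>+\<omega>. \<phi> (l1_norm (W \<omega>)) * ennreal (g (W \<omega>)) \<partial>M) =
        (\<integral>\<^sup>+x. ennreal (D x) * (\<phi> (l1_norm x) * ennreal (g x)) \<partial>lborel)"
      by (rule distributed_nn_integral[OF W', symmetric]) measurable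
    also have "\<dots> = (\<integral>\<^sup>+x. \<phi> (l1_norm x) * ennreal (C * (1 - l1_norm x) powr (\<beta>\<^sub>0 - 1)) *
        (G x * indicator {..1} (l1_norm x)) \<partial>lborel)"
    proof (intro nn_integral_cong)
      fix x
      show "ennreal (D x) * (\<phi> (l1_norm x) * ennreal (g x)) =
        \<phi> (l1_norm x) * ennreal (C * (1 - l1_norm x) powr (\<beta>\<^sub>0 - 1)) *
        (G x * indicator {..1} (l1_norm x))"
        using C P0[of x] g0[of x]
        by (cases "l1_norm x \<le> 1") (simp_all add: D G_def ennreal_mult mult_ac)
    qed
    finally show ?thesis .
  qed
  \<comment> \<open>Radial integration asks for \<open>H 1 < \<infinity>\<close>, while
    \<open>fin\<close> controls the integral of \<open>G\<close> only with the weight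
    \<open>(1 - s) powr (\<beta>\<^sub>0 - 1)\<close>, which vanishes at \<open>s = 1\<close> if
    \<open>\<beta>\<^sub>0 > 1\<close>. On the half ball \<open>1 - s\<close> lies between 1/2 and
    1, so \<open>m\<close> is a positive lower bound of \<open>C\<close> times the weight for either
    sign of the exponent.\<close>
  define m where "m = min 1 ((1/2) powr (\<beta>\<^sub>0 - 1)) * C"
  have m: "m > 0" unfolding m_def using C by simp
  have m_le: "m \<le> C * (1 - s) powr (\<beta>\<^sub>0 - 1)" if "0 \<le> s" "s \<le> 1/2" for s
  proof -
    have "min 1 ((1/2) powr (\<beta>\<^sub>0 - 1)) \<le> (1 - s) powr (\<beta>\<^sub>0 - 1)"
    proof (cases "\<beta>\<^sub>0 \<ge> 1")
      case True
      then have "(1/2) powr (\<beta>\<^sub>0 - 1) \<le> (1 - s) powr (\<beta>\<^sub>0 - 1)"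
        using that by (intro powr_mono2) auto
      then show ?thesis by simp
    next
      case False
      then have "1 powr (\<beta>\<^sub>0 - 1) \<le> (1 - s) powr (\<beta>\<^sub>0 - 1)"
        using that by (intro powr_mono2') auto
      then show ?thesis by simp
    qed
    then show ?thesis
      unfolding m_def using C by (simp add: mult.commute)
  qed
  define H where "H = (\<lambda>t. \<integral>\<^sup>+x. G x * indicator {..t} (l1_norm x) \<partial>lborel)"
  have "ennreal m * H (1/2) = (\<integral>\<^sup>+x. ennreal m * (G x * indicator {..1/2} (l1_norm x)) \<partial>lborel)"
    unfolding H_def by (rule nn_integral_cmult[symmetric]) measurable
  also have "\<dots> \<le> (\<integral>\<^sup>+x. 1 * ennreal (C * (1 - l1_norm x) powr (\<beta>\<^sub>0 - 1)) *
        (G x * indicator {..1} (l1_norm x)) \<partial>lborel)"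
  proof (rule nn_integral_mono)
    fix x :: "real ^ 'n"
    show "ennreal m * (G x * indicator {..1/2} (l1_norm x)) \<le>
      1 * ennreal (C * (1 - l1_norm x) powr (\<beta>\<^sub>0 - 1)) * (G x * indicator {..1} (l1_norm x))"
      using m_le[of "l1_norm x"]
      by (cases "l1_norm x \<le> 1/2") (auto intro!: mult_right_mono ennreal_leI)
  qed
  also have "\<dots> = (\<integral>\<^sup>+\<omega>. 1 * ennreal (g (W \<omega>)) \<partial>M)"
    by (rule EW[symmetric]) measurable
  finally have "ennreal m * H (1/2) \<le> (\<integral>\<^sup>+\<omega>. ennreal (g (W \<omega>)) \<partial>M)"
    by simp
  also note fin
  finally have "ennreal m * H (1/2) < \<infinity>" .
  then have "H (1/2) < \<infinity>"
    using m by (auto simp: ennreal_mult_less_top)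
  \<comment> \<open>By homogeneity the half ball carries a fixed positive fraction of
    \<open>H 1\<close>, so finiteness passes to the whole ball.\<close>
  moreover have "H (1/2) = ennreal ((1/2) powr (r + CARD('n))) * H 1"
    unfolding H_def by (rule nn_integral_l1_norm_ball[OF G Ghom]) auto
  ultimately have H: "H 1 < \<infinity>"
    by (auto simp: ennreal_mult_less_top)
  define a where "a = b + k"
  have a: "a = r + CARD('n)" "a > 0"
    unfolding a_def r_def using b k by auto
  show ?thesis
  proof (intro exI ballI)
    fix \<phi> :: "real \<Rightarrow> ennreal" assume [measurable]: "\<phi> \<in> borel_measurable borel"
    have "(\<integral>\<^sup>+\<omega>. \<phi> (l1_norm (W \<omega>)) * ennreal (g (W \<omega>)) \<partial>M) =
      H 1 * (\<integral>\<^sup>+s. \<phi> s * ennreal (C * (1 - s) powr (\<beta>\<^sub>0 - 1)) * ennreal (a * s powr (a - 1)) *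
        indicator {0..1} s \<partial>lborel)"
      unfolding H_def EW[OF \<open>\<phi> \<in> _\<close>]
      by (rule nn_integral_radial[OF G Ghom a H[unfolded H_def]]) measurable
    also have "(\<integral>\<^sup>+s. \<phi> s * ennreal (C * (1 - s) powr (\<beta>\<^sub>0 - 1)) * ennreal (a * s powr (a - 1)) *
        indicator {0..1} s \<partial>lborel) =
      (\<integral>\<^sup>+s. ennreal (C * a) * (\<phi> s * ennreal (s powr (a - 1) * (1 - s) powr (\<beta>\<^sub>0 - 1)) *
        indicator {0..1} s) \<partial>lborel)"
      using C a(2) by (intro nn_integral_cong) (simp add: ennreal_mult mult_ac)
    also have "\<dots> = ennreal (C * a) * (\<integral>\<^sup>+s. \<phi> s * ennreal (s powr (a - 1) * (1 - s) powr (\<beta>\<^sub>0 - 1)) *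
        indicator {0..1} s \<partial>lborel)"
      by (rule nn_integral_cmult) measurable
    finally show "(\<integral>\<^sup>+\<omega>. \<phi> (l1_norm (W \<omega>)) * ennreal (g (W \<omega>)) \<partial>M) =
      ennreal (C * a) * H 1 * (\<integral>\<^sup>+s. \<phi> s * ennreal (s powr ((\<Sum>i\<in>UNIV. \<beta> $ i) + k - 1) *
        (1 - s) powr (\<beta>\<^sub>0 - 1)) * indicator {0..1} s \<partial>lborel)"
      unfolding a_def b_def by (simp add: mult_ac)
  qed
qed

text \<open>The case \<open>g = 1\<close>, \<open>k = 0\<close> gives the law of the 1-norm up to a
  constant. Testing with \<open>\<phi> = 1\<close> compares total mass one with the Beta integral
  and fixes the constant.\<close>

lemma nn_integral_dirichlet_l1_norm:
  fixes W :: "'w \<Rightarrow> real ^ 'n" and \<phi> :: "real \<Rightarrow> ennreal"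
  assumes M: "prob_space M"
    and W: "distributed M lborel W (\<lambda>x. ennreal (dirichlet_density \<beta>\<^sub>0 \<beta> x))"
    and pos: "\<beta>\<^sub>0 > 0" "\<And>i. \<beta> $ i > 0"
    and [measurable]: "\<phi> \<in> borel_measurable borel"
  shows "(\<integral>\<^sup>+\<omega>. \<phi> (l1_norm (W \<omega>)) \<partial>M) =
    (\<integral>\<^sup>+s. \<phi> s * ennreal (beta_density (\<Sum>i\<in>UNIV. \<beta> $ i) \<beta>\<^sub>0 s) \<partial>lborel)"
proof -
  interpret prob_space M by fact
  define b where "b = (\<Sum>i\<in>UNIV. \<beta> $ i)"
  have b: "b > 0"
    unfolding b_def using pos by (intro sum_pos) auto
  obtain K where K: "\<forall>\<phi> \<in> borel_measurable borel.
      (\<integral>\<^sup>+\<omega>. \<phi> (l1_norm (W \<omega>)) * ennreal 1 \<partial>M) =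
      K * (\<integral>\<^sup>+s. \<phi> s * ennreal (s powr (b + 0 - 1) * (1 - s) powr (\<beta>\<^sub>0 - 1)) *
        indicator {0..1} s \<partial>lborel)"
    using nn_integral_dirichlet_homogeneous[OF W pos, of "\<lambda>_. 1" 0]
    unfolding b_def by (auto simp: emeasure_space_1)
  have "1 = K * ennreal (Beta b \<beta>\<^sub>0)"
    using K[rule_format, of "\<lambda>_. 1"] nn_integral_Beta[OF b pos(1)] by (simp add: emeasure_space_1)
  then have "K * ennreal (Beta b \<beta>\<^sub>0) * ennreal (1 / Beta b \<beta>\<^sub>0) = ennreal (1 / Beta b \<beta>\<^sub>0)"
    by simp
  then have "K = ennreal (1 / Beta b \<beta>\<^sub>0)"
    using Beta_pos_real[OF b pos(1)] by (simp add: mult.assoc ennreal_mult'[symmetric])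
  then have "(\<integral>\<^sup>+\<omega>. \<phi> (l1_norm (W \<omega>)) \<partial>M) = (\<integral>\<^sup>+s. ennreal (1 / Beta b \<beta>\<^sub>0) *
      (\<phi> s * ennreal (s powr (b - 1) * (1 - s) powr (\<beta>\<^sub>0 - 1)) * indicator {0..1} s) \<partial>lborel)"
    using K[rule_format, of \<phi>] by (subst nn_integral_cmult) auto
  also have "\<dots> = (\<integral>\<^sup>+s. \<phi> s * ennreal (beta_density b \<beta>\<^sub>0 s) \<partial>lborel)"
    using Beta_pos_real[OF b pos(1)]
    by (intro nn_integral_cong)
      (auto simp: beta_density_def indicator_def ennreal_mult'[symmetric] mult.left_commute)
  finally show ?thesis unfolding b_def .
qed

text \<open>For a common degree \<open>k\<close>, both integrals are multiples of the same
  \<open>I \<phi>\<close>, with factors \<open>K\<close> and \<open>L\<close>; both sides then equal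
  \<open>K * L * I \<phi> * I (\<lambda>_. 1)\<close>. The product form avoids division in
  \<open>ennreal\<close>. Behind it stands the independence of the 1-norm of \<open>W\<close> and
  the direction of \<open>W\<close>.\<close>

lemma nn_integral_dirichlet_homogeneous_eq:
  fixes W :: "'w \<Rightarrow> real ^ 'n" and f g :: "real ^ 'n \<Rightarrow> real" and \<phi> :: "real \<Rightarrow> ennreal"
  assumes W: "distributed M lborel W (\<lambda>x. ennreal (dirichlet_density \<beta>\<^sub>0 \<beta> x))"
    and pos: "\<beta>\<^sub>0 > 0" "\<And>i. \<beta> $ i > 0"
    and f: "f \<in> borel_measurable borel" "\<And>x. f x \<ge> 0"
      "\<And>c x. c > 0 \<Longrightarrow> f (c *\<^sub>R x) = c powr k * f x" "(\<integral>\<^sup>+\<omega>. ennreal (f (W \<omega>)) \<partial>M) < \<infinity>"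
    and g: "g \<in> borel_measurable borel" "\<And>x. g x \<ge> 0"
      "\<And>c x. c > 0 \<Longrightarrow> g (c *\<^sub>R x) = c powr k * g x" "(\<integral>\<^sup>+\<omega>. ennreal (g (W \<omega>)) \<partial>M) < \<infinity>"
    and k: "k \<ge> 0" and \<phi>: "\<phi> \<in> borel_measurable borel"
  shows "(\<integral>\<^sup>+\<omega>. \<phi> (l1_norm (W \<omega>)) * ennreal (f (W \<omega>)) \<partial>M) * (\<integral>\<^sup>+\<omega>. ennreal (g (W \<omega>)) \<partial>M) =
    (\<integral>\<^sup>+\<omega>. \<phi> (l1_norm (W \<omega>)) * ennreal (g (W \<omega>)) \<partial>M) * (\<integral>\<^sup>+\<omega>. ennreal (f (W \<omega>)) \<partial>M)"
proof -
  define I where "I = (\<lambda>\<phi>::real \<Rightarrow> ennreal. \<integral>\<^sup>+s. \<phi> s *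
    ennreal (s powr ((\<Sum>i\<in>UNIV. \<beta> $ i) + k - 1) * (1 - s) powr (\<beta>\<^sub>0 - 1)) * indicator {0..1} s \<partial>lborel)"
  obtain K where K: "\<forall>\<phi> \<in> borel_measurable borel.
      (\<integral>\<^sup>+\<omega>. \<phi> (l1_norm (W \<omega>)) * ennreal (f (W \<omega>)) \<partial>M) = K * I \<phi>"
    using nn_integral_dirichlet_homogeneous[OF W pos f(1,2,3) k f(4)] unfolding I_def ..
  obtain L where L: "\<forall>\<phi> \<in> borel_measurable borel.
      (\<integral>\<^sup>+\<omega>. \<phi> (l1_norm (W \<omega>)) * ennreal (g (W \<omega>)) \<partial>M) = L * I \<phi>"
    using nn_integral_dirichlet_homogeneous[OF W pos g(1,2,3) k g(4)] unfolding I_def ..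
  from K[rule_format, OF \<phi>] L[rule_format, OF \<phi>]
    K[rule_format, of "\<lambda>_. 1"] L[rule_format, of "\<lambda>_. 1"] show ?thesis
    by (simp add: mult_ac)
qed

text \<open>Almost surely \<open>V\<close> is one minus the 1-norm of \<open>W\<close>, whose law is
  Beta with parameters \<open>b\<close> and \<open>\<beta>\<^sub>0\<close>; the reflection
  \<open>u \<mapsto> 1 - u\<close> exchanges the two parameters.\<close>

lemma dirichlet_first_component_beta:
  fixes W :: "'w \<Rightarrow> real ^ 'n"
  assumes M: "prob_space M"
    and W: "distributed M lborel W (\<lambda>x. ennreal (dirichlet_density \<beta>\<^sub>0 \<beta> x))"
    and pos: "\<beta>\<^sub>0 > 0" "\<And>i. \<beta> $ i > 0"
    and V [measurable]: "V \<in> borel_measurable M" and VW: "AE \<omega> in M. V \<omega> = 1 - l1_norm (W \<omega>)"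
  shows "distr M borel V = beta_law \<beta>\<^sub>0 (\<Sum>i\<in>UNIV. \<beta> $ i)"
proof (rule measure_eqI)
  define b where "b = (\<Sum>i\<in>UNIV. \<beta> $ i)"
  fix A assume "A \<in> sets (distr M borel V)"
  then have A [measurable]: "A \<in> sets borel" by simp
  have "emeasure (distr M borel V) A = (\<integral>\<^sup>+\<omega>. indicator A (V \<omega>) \<partial>M)"
    by (simp add: nn_integral_distr flip: nn_integral_indicator)
  also have "\<dots> = (\<integral>\<^sup>+\<omega>. indicator A (1 - l1_norm (W \<omega>)) \<partial>M)"
    using VW by (intro nn_integral_cong_AE) auto
  also have "\<dots> = (\<integral>\<^sup>+s. indicator A (1 - s) * ennreal (beta_density b \<beta>\<^sub>0 s) \<partial>lborel)"
    unfolding b_def by (rule nn_integral_dirichlet_l1_norm[OF M W pos]) measurable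
  also have "\<dots> = (\<integral>\<^sup>+u. indicator A u * ennreal (beta_density b \<beta>\<^sub>0 (1 - u)) \<partial>lborel)"
    using nn_integral_real_affine[of "\<lambda>s. indicator A (1 - s) * ennreal (beta_density b \<beta>\<^sub>0 s)" "-1" 1]
    by simp
  also have "\<dots> = emeasure (beta_law \<beta>\<^sub>0 b) A"
    unfolding beta_law_def
    by (subst emeasure_density)
      (auto intro!: nn_integral_cong simp: beta_density_def Beta_commute mult_ac)
  finally show "emeasure (distr M borel V) A = emeasure (beta_law \<beta>\<^sub>0 (\<Sum>i\<in>UNIV. \<beta> $ i)) A"
    unfolding b_def .
qed (simp add: beta_law_def)

text \<open>The extra factor \<open>u\<close> raises the first parameter by one, so the mean is
  \<open>Beta (a + 1) b / Beta a b\<close>, which the recursion of the Beta function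
  evaluates.\<close>

lemma integral_beta_law_id:
  assumes "a > 0" "b > 0"
  shows "(\<integral>u. u \<partial>beta_law a b) = a / (a + b)"
proof -
  have B: "Beta a b > 0" using assms by (rule Beta_pos_real)
  have "(\<integral>u. u \<partial>beta_law a b) = (\<integral>u. beta_density a b u *\<^sub>R u \<partial>lborel)"
    unfolding beta_law_def using B
    by (intro integral_density) (auto simp: beta_density_def)
  also have "\<dots> = enn2real (\<integral>\<^sup>+u. ennreal (beta_density a b u *\<^sub>R u) \<partial>lborel)"
    using B by (intro integral_eq_nn_integral) (auto simp: beta_density_def)
  also have "(\<integral>\<^sup>+u. ennreal (beta_density a b u *\<^sub>R u) \<partial>lborel) =
      (\<integral>\<^sup>+u. ennreal (1 / Beta a b) *
        (ennreal (u powr (a + 1 - 1) * (1 - u) powr (b - 1)) * indicator {0..1} u) \<partial>lborel)"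
  proof (intro nn_integral_cong)
    fix u :: real
    show "ennreal (beta_density a b u *\<^sub>R u) = ennreal (1 / Beta a b) *
        (ennreal (u powr (a + 1 - 1) * (1 - u) powr (b - 1)) * indicator {0..1} u)"
      using B powr_add[of u "a - 1" 1]
      by (auto simp: beta_density_def indicator_def ennreal_mult'[symmetric] mult_ac)
  qed
  also have "\<dots> = ennreal (1 / Beta a b) * ennreal (Beta (a + 1) b)"
    using assms by (subst nn_integral_cmult) (auto simp: nn_integral_Beta[of "a + 1" b, simplified])
  also have "enn2real \<dots> = Beta (a + 1) b / Beta a b"
    using B Beta_pos_real[of "a + 1" b] assms by (simp add: ennreal_mult'[symmetric])
  also have "\<dots> = a / (a + b)"
  proof -
    have "a \<notin> \<int>\<^sub>\<le>\<^sub>0" using assms(1) by (auto elim!: nonpos_Ints_cases)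
    from Beta_plus1_left[OF this, of b] show ?thesis
      using assms B by (simp add: field_simps)
  qed
  finally show ?thesis .
qed

section \<open>Pareto tails\<close>

lemma Int_stable_vimage: "Int_stable {f -` A \<inter> S | A. A \<in> sets N}"
proof (rule Int_stableI)
  fix a b assume "a \<in> {f -` A \<inter> S | A. A \<in> sets N}" "b \<in> {f -` A \<inter> S | A. A \<in> sets N}"
  then obtain A B where AB: "A \<in> sets N" "a = f -` A \<inter> S" "B \<in> sets N" "b = f -` B \<inter> S"
    by auto
  then have "a \<inter> b = f -` (A \<inter> B) \<inter> S" "A \<inter> B \<in> sets N"
    by auto
  then show "a \<inter> b \<in> {f -` A \<inter> S | A. A \<in> sets N}"
    by (intro CollectI exI[of _ "A \<inter> B"] conjI)
qed

text \<open>Events of \<open>\<zeta> (U \<omega>)\<close> are among the events of \<open>U\<close>,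
  so independence is inherited. This passes from the formulation by sigma-algebras to
  \<open>indep_var\<close> for real functions of \<open>(V, W)\<close>.\<close>

lemma (in prob_space) indep_var_of_indep_set_vimage:
  fixes U :: "'a \<Rightarrow> 'b :: topological_space" and \<zeta> :: "'b \<Rightarrow> 'c :: topological_space"
  assumes [measurable]: "\<xi> \<in> borel_measurable M" "U \<in> borel_measurable M" "\<zeta> \<in> borel_measurable borel"
    and "indep_set {\<xi> -` A \<inter> space M | A. A \<in> sets borel} {U -` B \<inter> space M | B. B \<in> sets borel}"
  shows "indep_var borel \<xi> borel (\<lambda>\<omega>. \<zeta> (U \<omega>))"
proof -
  have "{(\<lambda>\<omega>. \<zeta> (U \<omega>)) -` B \<inter> space M | B. B \<in> sets borel} \<subseteq> {U -` B \<inter> space M | B. B \<in> sets borel}"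
  proof
    fix S assume "S \<in> {(\<lambda>\<omega>. \<zeta> (U \<omega>)) -` B \<inter> space M | B. B \<in> sets borel}"
    then obtain B where B: "B \<in> sets borel" "S = (\<lambda>\<omega>. \<zeta> (U \<omega>)) -` B \<inter> space M"
      by auto
    then have "S = U -` (\<zeta> -` B) \<inter> space M" "\<zeta> -` B \<in> sets borel"
      using measurable_sets_borel[OF assms(3)] by auto
    then show "S \<in> {U -` B \<inter> space M | B. B \<in> sets borel}"
      by (intro CollectI exI[of _ "\<zeta> -` B"] conjI)
  qed
  moreover have "{(\<lambda>\<omega>. \<zeta> (U \<omega>)) -` B \<inter> space M | B. B \<in> sets borel} \<subseteq> events"
    by auto
  ultimately have "indep_set {\<xi> -` A \<inter> space M | A. A \<in> sets borel}
      {(\<lambda>\<omega>. \<zeta> (U \<omega>)) -` B \<inter> space M | B. B \<in> sets borel}"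
    using assms(4) unfolding indep_sets2_eq by (meson subset_iff)
  then show ?thesis
    unfolding indep_var_eq by (intro conjI indep_set_sigma_sets Int_stable_vimage) simp_all
qed

text \<open>By Fubini, conditioning on \<open>Z = z\<close> leaves the probability that
  \<open>\<xi> > t / z\<close>. The bound \<open>z \<le> t\<close> puts \<open>t / z\<close> into
  the range of the Pareto formula, giving exactly \<open>z / t\<close>; for \<open>z = 0\<close> the
  event is empty. Averaging over \<open>z\<close> gives the claim.\<close>

lemma (in prob_space) standard_pareto_mult_tail:
  assumes \<xi>: "standard_pareto M \<xi>" and indep: "indep_var borel \<xi> borel Z"
    and Z: "AE \<omega> in M. 0 \<le> Z \<omega> \<and> Z \<omega> \<le> t" and t: "t > 0"
  shows "\<P>(\<omega> in M. \<xi> \<omega> * Z \<omega> > t) = expectation Z / t"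
proof -
  have [measurable]: "\<xi> \<in> borel_measurable M" "Z \<in> borel_measurable M"
    using indep unfolding indep_var_eq by auto
  interpret D: pair_prob_space "distr M borel \<xi>" "distr M borel Z"
    by (intro pair_prob_space.intro pair_sigma_finite.intro prob_space_imp_sigma_finite prob_space_distr)
      auto
  define A where "A = {p :: real \<times> real. fst p * snd p > t}"
  have A [measurable]: "A \<in> sets (borel \<Otimes>\<^sub>M borel)"
    unfolding borel_prod A_def by (intro borel_open open_Collect_less continuous_intros)
  have A': "A \<in> sets (distr M borel \<xi> \<Otimes>\<^sub>M distr M borel Z)"
    using A by (simp cong: sets_pair_measure_cong)
  have "ennreal (\<P>(\<omega> in M. \<xi> \<omega> * Z \<omega> > t)) = emeasure M {\<omega> \<in> space M. \<xi> \<omega> * Z \<omega> > t}"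
    by (simp add: emeasure_eq_measure)
  also have "\<dots> = emeasure (distr M (borel \<Otimes>\<^sub>M borel) (\<lambda>\<omega>. (\<xi> \<omega>, Z \<omega>))) A"
    by (subst emeasure_distr[OF _ A]) (simp_all add: A_def vimage_def Int_def conj_commute)
  also have "\<dots> = emeasure (distr M borel \<xi> \<Otimes>\<^sub>M distr M borel Z) A"
    using indep unfolding indep_var_distribution_eq by simp
  also have "\<dots> = (\<integral>\<^sup>+z. emeasure (distr M borel \<xi>) ((\<lambda>x. (x, z)) -` A) \<partial>distr M borel Z)"
    by (rule D.emeasure_pair_measure_alt2[OF A'])
  also have "\<dots> = (\<integral>\<^sup>+z. ennreal (z / t) \<partial>distr M borel Z)"
  proof (rule nn_integral_cong_AE)
    have *: "emeasure (distr M borel \<xi>) ((\<lambda>x. (x, z)) -` A) = ennreal (z / t)"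
      if z: "0 \<le> z" "z \<le> t" for z
    proof (cases "z = 0")
      case True
      then show ?thesis using t by (simp add: A_def vimage_def)
    next
      case False
      with z have "z > 0" by simp
      then have *: "(\<lambda>x. (x, z)) -` A = {t / z <..}"
        by (auto simp: A_def pos_divide_less_eq)
      have "emeasure (distr M borel \<xi>) {t / z <..} = emeasure M (\<xi> -` {t / z <..} \<inter> space M)"
        by (rule emeasure_distr) simp_all
      also have "\<xi> -` {t / z <..} \<inter> space M = {\<omega> \<in> space M. \<xi> \<omega> > t / z}"
        by blast
      also have "emeasure M \<dots> = ennreal (\<P>(\<omega> in M. \<xi> \<omega> > t / z))"
        by (rule emeasure_eq_measure)
      also have "\<P>(\<omega> in M. \<xi> \<omega> > t / z) = z / t"
      proof -
        have "1 \<le> t / z" using z(2) \<open>z > 0\<close> by simp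
        with \<xi> show ?thesis unfolding standard_pareto_def by simp
      qed
      finally show ?thesis unfolding * .
    qed
    show "AE z in distr M borel Z. emeasure (distr M borel \<xi>) ((\<lambda>x. (x, z)) -` A) = ennreal (z / t)"
    proof -
      have "AE z in distr M borel Z. 0 \<le> z \<and> z \<le> t"
        using Z by (subst AE_distr_iff) auto
      then show ?thesis by eventually_elim (use * in auto)
    qed
  qed
  also have "\<dots> = (\<integral>\<^sup>+\<omega>. ennreal (Z \<omega> / t) \<partial>M)"
    by (subst nn_integral_distr) auto
  also have "\<dots> = ennreal (\<integral>\<omega>. Z \<omega> / t \<partial>M)"
  proof (rule nn_integral_eq_integral)
    show "integrable M (\<lambda>\<omega>. Z \<omega> / t)"
    proof (rule integrable_const_bound[where B=1])
      show "AE \<omega> in M. norm (Z \<omega> / t) \<le> 1"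
        using Z by eventually_elim (use t in auto)
    qed simp
    show "AE \<omega> in M. 0 \<le> Z \<omega> / t"
      using Z by eventually_elim (use t in auto)
  qed
  finally have "ennreal (\<P>(\<omega> in M. \<xi> \<omega> * Z \<omega> > t)) = ennreal (expectation Z / t)"
    by simp
  moreover have "expectation Z / t \<ge> 0"
  proof (intro divide_nonneg_pos integral_nonneg_AE t)
    show "AE \<omega> in M. 0 \<le> Z \<omega>" using Z by eventually_elim auto
  qed
  ultimately show ?thesis by simp
qed

section \<open>Quantiles and precision for exact power tails\<close>

lemma power_tail_le_iff:
  fixes m p x :: real
  assumes "x > 0" "p < 1"
  shows "p \<le> 1 - m / x \<longleftrightarrow> m / (1 - p) \<le> x"
proof -
  have "p \<le> 1 - m / x \<longleftrightarrow> m \<le> (1 - p) * x"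
    using pos_divide_le_eq[OF assms(1), of m "1 - p"] by linarith
  also have "\<dots> \<longleftrightarrow> m / (1 - p) \<le> x"
    using pos_divide_le_eq[of "1 - p" m x] assms(2) by (simp add: mult.commute)
  finally show ?thesis .
qed

text \<open>From \<open>B\<close> on the distribution function is \<open>1 - m / x\<close>, and a
  level \<open>p\<close> above its value at \<open>B\<close> is reached only beyond
  \<open>B\<close>. Hence the set in the definition of the quantile is the half-line starting at
  \<open>m / (1 - p)\<close>.\<close>

lemma (in prob_space) quantile_of_power_tail:
  assumes [measurable]: "Z \<in> borel_measurable M"
    and B: "B > 0" and m: "m > 0" and tail: "\<And>t. t \<ge> B \<Longrightarrow> \<P>(\<omega> in M. Z \<omega> > t) = m / t"
    and p: "1 - m / B < p" "p < 1"
  shows "quantile M Z p = m / (1 - p)"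
proof -
  have cdf: "cdf (distr M borel Z) x = 1 - \<P>(\<omega> in M. Z \<omega> > x)" for x
  proof -
    have "cdf (distr M borel Z) x = \<P>(\<omega> in M. Z \<omega> \<le> x)"
      unfolding cdf_def by (subst measure_distr) (auto intro!: arg_cong2[where f=measure])
    also have "\<dots> = 1 - \<P>(\<omega> in M. \<not> Z \<omega> \<le> x)"
      by (subst prob_neg) auto
    finally show ?thesis by (simp add: not_le)
  qed
  have "p \<le> cdf (distr M borel Z) x \<longleftrightarrow> m / (1 - p) \<le> x" for x
  proof (cases "x \<ge> B")
    case True
    then show ?thesis
      using power_tail_le_iff[of x p m] B p(2) unfolding cdf tail[OF True] by simp
  next
    case False
    \<comment> \<open>Below \<open>B\<close> only monotonicity is available: the distribution
      function is at most its value \<open>1 - m / B\<close> at \<open>B\<close>, which is less than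
      \<open>p\<close>.\<close>
    then have "\<P>(\<omega> in M. Z \<omega> > B) \<le> \<P>(\<omega> in M. Z \<omega> > x)"
      by (intro finite_measure_mono) auto
    then have "\<not> p \<le> cdf (distr M borel Z) x"
      using p tail[of B] unfolding cdf by simp
    moreover have "B < m / (1 - p)"
      using power_tail_le_iff[OF B p(2), of m] p(1) by linarith
    ultimately show ?thesis using False by simp
  qed
  then have "{x. p \<le> cdf (distr M borel Z) x} = {m / (1 - p)..}"
    by auto
  then show ?thesis unfolding quantile_def by simp
qed

text \<open>Equal tails force equal quantiles \<open>t = m / (1 - p)\<close>, and \<open>t\<close>
  exceeds \<open>B\<close>. The conditional probability is then \<open>(j / t) / (m / t)\<close>,
  where \<open>t\<close> cancels.\<close>

lemma (in prob_space) precision_of_power_tail: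
  assumes [measurable]: "Y \<in> borel_measurable M" "Z \<in> borel_measurable M"
    and B: "B > 0" and m: "m > 0"
    and Y: "\<And>t. t \<ge> B \<Longrightarrow> \<P>(\<omega> in M. Y \<omega> > t) = m / t"
    and Z: "\<And>t. t \<ge> B \<Longrightarrow> \<P>(\<omega> in M. Z \<omega> > t) = m / t"
    and YZ: "\<And>t. t \<ge> B \<Longrightarrow> \<P>(\<omega> in M. Y \<omega> > t \<and> Z \<omega> > t) = j / t"
    and p: "1 - m / B < p" "p < 1"
  shows "precision M Y Z p = j / m"
proof -
  have "B < m / (1 - p)"
    using power_tail_le_iff[OF B p(2), of m] p(1) by linarith
  with B m p show ?thesis
    using quantile_of_power_tail[OF assms(1) B m Y p] quantile_of_power_tail[OF assms(2) B m Z p]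
    unfolding precision_def cond_prob_def by (simp add: YZ Z)
qed

section \<open>Optimality of the 1-norm\<close>

text \<open>The locale fixes witnesses of the existential quantifier in
  \<open>pareto_dirichlet\<close>, since the argument runs on \<open>V\<close> and \<open>W\<close>
  instead of \<open>Y\<close> and \<open>X\<close>.\<close>

locale pareto_dirichlet_representation = prob_space M
  for M :: "'w measure" +
  fixes \<beta>\<^sub>0 :: real and \<beta> :: "real ^ 'n" and Y :: "'w \<Rightarrow> real" and X :: "'w \<Rightarrow> real ^ 'n"
    and \<xi> V :: "'w \<Rightarrow> real" and W :: "'w \<Rightarrow> real ^ 'n"
  assumes pos: "\<beta>\<^sub>0 > 0" "\<And>i. \<beta> $ i > 0"
    and Y_meas [measurable]: "Y \<in> borel_measurable M" and X_meas [measurable]: "X \<in> borel_measurable M"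
    and pareto: "standard_pareto M \<xi>" and dirichlet: "dirichlet M \<beta>\<^sub>0 \<beta> V W"
    and indep: "indep_set {\<xi> -` A \<inter> space M | A. A \<in> sets borel}
      {(\<lambda>\<omega>. (V \<omega>, W \<omega>)) -` B \<inter> space M | B. B \<in> sets borel}"
    and rep: "AE \<omega> in M. Y \<omega> = \<xi> \<omega> * V \<omega> \<and> X \<omega> = \<xi> \<omega> *\<^sub>R W \<omega>"
begin

section \<open>Moments and almost sure bounds of the representation\<close>

definition "beta_sum = (\<Sum>i\<in>UNIV. \<beta> $ i)"

text \<open>The expectation of \<open>V\<close>, as \<open>expectation_V\<close> confirms.\<close>

definition "mean = \<beta>\<^sub>0 / (\<beta>\<^sub>0 + beta_sum)"

lemma beta_sum_pos: "beta_sum > 0"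
  unfolding beta_sum_def using pos by (intro sum_pos) auto

lemma mean_pos: "mean > 0" and mean_less_1: "mean < 1"
  using pos(1) beta_sum_pos by (auto simp: mean_def)

text \<open>The constant \<open>\<beta>\<^sub>0 / beta_sum\<close> is the odds of
  \<open>mean\<close>. It is the factor that lifts the expected 1-norm of \<open>W\<close>, namely
  \<open>1 - mean\<close>, to the expectation of \<open>V\<close>.\<close>

lemma mean_odds: "mean = \<beta>\<^sub>0 / beta_sum * (1 - mean)"
  using pos(1) beta_sum_pos by (simp add: mean_def field_simps)

lemma W_distributed: "distributed M lborel W (\<lambda>x. ennreal (dirichlet_density \<beta>\<^sub>0 \<beta> x))"
  using dirichlet unfolding dirichlet_def by simp

lemma V_meas [measurable]: "V \<in> borel_measurable M"
  using dirichlet unfolding dirichlet_def by simp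

lemma W_meas [measurable]: "W \<in> borel_measurable M"
  using distributed_measurable[OF W_distributed] by simp

lemma AE_simplex: "AE \<omega> in M. l1_norm (W \<omega>) \<le> 1 \<and> V \<omega> = 1 - l1_norm (W \<omega>)"
proof -
  have "AE \<omega> in M. (\<forall>i. 0 \<le> W \<omega> $ i) \<and> (\<Sum>i\<in>UNIV. W \<omega> $ i) \<le> 1"
    by (subst distributed_AE2[OF W_distributed]) (auto simp: dirichlet_density_def)
  moreover have "AE \<omega> in M. V \<omega> + (\<Sum>i\<in>UNIV. W \<omega> $ i) = 1"
    using dirichlet unfolding dirichlet_def by simp
  ultimately show ?thesis
    by eventually_elim (auto simp: l1_norm_of_nonneg)
qed

text \<open>Evaluating the Pareto tail at 1 gives probability one. Positivity of
  \<open>\<xi>\<close> is what lets it be pulled out of homogeneous functions and minima.\<close>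

lemma AE_pareto_gt_1: "AE \<omega> in M. \<xi> \<omega> > 1"
proof -
  have [measurable]: "\<xi> \<in> borel_measurable M"
    using pareto unfolding standard_pareto_def by simp
  have "prob {\<omega> \<in> space M. \<xi> \<omega> > 1} = 1"
    using pareto unfolding standard_pareto_def by simp
  from AE_prob_1[OF this] show ?thesis by simp
qed

lemma V_law: "distr M borel V = beta_law \<beta>\<^sub>0 beta_sum"
  unfolding beta_sum_def
proof (rule dirichlet_first_component_beta[OF prob_space_axioms W_distributed pos V_meas])
  show "AE \<omega> in M. V \<omega> = 1 - l1_norm (W \<omega>)"
    using AE_simplex by eventually_elim simp
qed

lemma integrable_of_bounded:
  fixes f :: "'w \<Rightarrow> real"
  assumes "f \<in> borel_measurable M" "AE \<omega> in M. 0 \<le> f \<omega> \<and> f \<omega> \<le> B"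
  shows "integrable M f"
proof (rule integrable_const_bound[where B=B])
  show "AE \<omega> in M. norm (f \<omega>) \<le> B"
    using assms(2) by eventually_elim simp
qed fact

lemma expectation_V: "expectation V = mean"
proof -
  have "expectation V = (\<integral>u. u \<partial>distr M borel V)"
    by (subst integral_distr) auto
  then show ?thesis
    unfolding V_law mean_def using integral_beta_law_id[OF pos(1) beta_sum_pos] by simp
qed

lemma integrable_l1_norm_W: "integrable M (\<lambda>\<omega>. l1_norm (W \<omega>))"
proof (rule integrable_of_bounded)
  show "AE \<omega> in M. 0 \<le> l1_norm (W \<omega>) \<and> l1_norm (W \<omega>) \<le> 1"
    using AE_simplex by eventually_elim simp
qed simp

lemma expectation_l1_norm: "expectation (\<lambda>\<omega>. l1_norm (W \<omega>)) = 1 - mean"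
proof -
  have "mean = expectation (\<lambda>\<omega>. 1 - l1_norm (W \<omega>))"
    unfolding expectation_V[symmetric]
  proof (rule integral_cong_AE)
    show "AE \<omega> in M. V \<omega> = 1 - l1_norm (W \<omega>)"
      using AE_simplex by eventually_elim simp
  qed simp_all
  then show ?thesis
    using integrable_l1_norm_W by (simp add: prob_space)
qed

text \<open>A common form for the tails of \<open>Y\<close>, of \<open>g (X \<omega>)\<close> and of
  their minimum. The predicate \<open>Q\<close> is tied to \<open>\<xi>\<close>, \<open>V\<close>
  and \<open>W\<close> only almost everywhere, as is the representation of \<open>Y\<close> and
  \<open>X\<close>.\<close>

lemma tail_probability:
  fixes \<zeta> :: "real \<times> (real ^ 'n) \<Rightarrow> real"
  assumes [measurable]: "\<zeta> \<in> borel_measurable borel" "Measurable.pred M Q"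
    and Q: "AE \<omega> in M. Q \<omega> \<longleftrightarrow> \<xi> \<omega> * \<zeta> (V \<omega>, W \<omega>) > t"
    and bd: "AE \<omega> in M. 0 \<le> \<zeta> (V \<omega>, W \<omega>) \<and> \<zeta> (V \<omega>, W \<omega>) \<le> t" and t: "t > 0"
  shows "\<P>(\<omega> in M. Q \<omega>) = expectation (\<lambda>\<omega>. \<zeta> (V \<omega>, W \<omega>)) / t"
proof -
  have \<xi> [measurable]: "\<xi> \<in> borel_measurable M"
    using pareto unfolding standard_pareto_def by simp
  have VW: "(\<lambda>\<omega>. (V \<omega>, W \<omega>)) \<in> borel_measurable M"
    by (intro borel_measurable_Pair) auto
  have [measurable]: "(\<lambda>\<omega>. \<zeta> (V \<omega>, W \<omega>)) \<in> borel_measurable M"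
    by (rule measurable_compose[OF VW]) simp
  have "\<P>(\<omega> in M. Q \<omega>) = \<P>(\<omega> in M. \<xi> \<omega> * \<zeta> (V \<omega>, W \<omega>) > t)"
  proof (rule prob_eq_AE)
    show "AE \<omega> in M. Q \<omega> \<longleftrightarrow> \<xi> \<omega> * \<zeta> (V \<omega>, W \<omega>) > t"
      by (rule Q)
  qed measurable
  also have "\<dots> = expectation (\<lambda>\<omega>. \<zeta> (V \<omega>, W \<omega>)) / t"
    by (intro standard_pareto_mult_tail pareto bd t
        indep_var_of_indep_set_vimage[OF \<xi> VW assms(1) indep])
  finally show ?thesis .
qed

lemma tail_Y:
  assumes "t \<ge> 1"
  shows "\<P>(\<omega> in M. Y \<omega> > t) = mean / t"
proof -
  have "\<P>(\<omega> in M. Y \<omega> > t) = expectation (\<lambda>\<omega>. fst (V \<omega>, W \<omega>)) / t"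
  proof (rule tail_probability)
    show "(fst :: real \<times> (real ^ 'n) \<Rightarrow> real) \<in> borel_measurable borel"
      unfolding borel_prod[symmetric] by measurable
    show "AE \<omega> in M. (Y \<omega> > t) = (\<xi> \<omega> * fst (V \<omega>, W \<omega>) > t)"
      using rep by eventually_elim auto
    show "AE \<omega> in M. 0 \<le> fst (V \<omega>, W \<omega>) \<and> fst (V \<omega>, W \<omega>) \<le> t"
      using AE_simplex by eventually_elim (use assms in \<open>auto intro: order_trans[of _ 1]\<close>)
  qed (use assms in auto)
  then show ?thesis by (simp add: expectation_V)
qed

section \<open>Tails, calibration and precision of a homogeneous functional dominated by the
  1-norm\<close>

context
  fixes g :: "real ^ 'n \<Rightarrow> real" and B :: real
  assumes g [measurable]: "g \<in> borel_measurable borel" and g_nonneg: "\<And>x. 0 \<le> g x"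
    and g_hom: "\<And>c x. c \<ge> 0 \<Longrightarrow> g (c *\<^sub>R x) = c * g x"
    and g_le: "\<And>x. g x \<le> B * l1_norm x"
begin

text \<open>On the simplex the 1-norm is at most 1, so \<open>B\<close> bounds
  \<open>g (W \<omega>)\<close> and 1 bounds \<open>V\<close>. The level \<open>max 1 B\<close>
  serves both and is the point from which all tails are exactly of the form constant over
  \<open>t\<close>.\<close>

lemma AE_bounds:
  "AE \<omega> in M. 0 \<le> V \<omega> \<and> V \<omega> \<le> 1 \<and> 0 \<le> g (W \<omega>) \<and> g (W \<omega>) \<le> max 1 B"
  using AE_simplex
proof eventually_elim
  case (elim \<omega>)
  have "g (W \<omega>) \<le> B * l1_norm (W \<omega>)" by (rule g_le)
  also have "\<dots> \<le> max 1 B * l1_norm (W \<omega>)" by (intro mult_right_mono) auto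
  also have "\<dots> \<le> max 1 B * 1" using elim by (intro mult_left_mono) auto
  finally show ?case using elim by (auto simp: g_nonneg)
qed

lemma integrable_g_W: "integrable M (\<lambda>\<omega>. g (W \<omega>))"
proof (rule integrable_of_bounded)
  show "AE \<omega> in M. 0 \<le> g (W \<omega>) \<and> g (W \<omega>) \<le> max 1 B"
    using AE_bounds by eventually_elim simp
qed simp

lemma tail_g:
  assumes "t \<ge> max 1 B"
  shows "\<P>(\<omega> in M. g (X \<omega>) > t) = expectation (\<lambda>\<omega>. g (W \<omega>)) / t"
proof -
  have "\<P>(\<omega> in M. g (X \<omega>) > t) = expectation (\<lambda>\<omega>. (\<lambda>p. g (snd p)) (V \<omega>, W \<omega>)) / t"
  proof (rule tail_probability)
    show "(\<lambda>p :: real \<times> (real ^ 'n). g (snd p)) \<in> borel_measurable borel"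
      unfolding borel_prod[symmetric] by measurable
    show "AE \<omega> in M. (g (X \<omega>) > t) = (\<xi> \<omega> * g (snd (V \<omega>, W \<omega>)) > t)"
      using rep AE_pareto_gt_1 by eventually_elim (auto simp: g_hom)
    show "AE \<omega> in M. 0 \<le> g (snd (V \<omega>, W \<omega>)) \<and> g (snd (V \<omega>, W \<omega>)) \<le> t"
      using AE_bounds by eventually_elim (use assms in auto)
  qed (use assms in auto)
  then show ?thesis by simp
qed

text \<open>Two quantities exceed \<open>t\<close> exactly when their minimum does, and for positive
  \<open>\<xi>\<close> the minimum of \<open>Y\<close> and \<open>g (X \<omega>)\<close> is
  \<open>\<xi>\<close> times the minimum of \<open>V\<close> and
  \<open>g (W \<omega>)\<close>.\<close>

lemma tail_joint:
  assumes "t \<ge> max 1 B"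
  shows "\<P>(\<omega> in M. Y \<omega> > t \<and> g (X \<omega>) > t) = expectation (\<lambda>\<omega>. min (V \<omega>) (g (W \<omega>))) / t"
proof -
  have "\<P>(\<omega> in M. Y \<omega> > t \<and> g (X \<omega>) > t) =
      expectation (\<lambda>\<omega>. (\<lambda>p. min (fst p) (g (snd p))) (V \<omega>, W \<omega>)) / t"
  proof (rule tail_probability)
    show "(\<lambda>p :: real \<times> (real ^ 'n). min (fst p) (g (snd p))) \<in> borel_measurable borel"
      unfolding borel_prod[symmetric] by measurable
    show "AE \<omega> in M. (Y \<omega> > t \<and> g (X \<omega>) > t) =
        (\<xi> \<omega> * min (fst (V \<omega>, W \<omega>)) (g (snd (V \<omega>, W \<omega>))) > t)"
      using rep AE_pareto_gt_1
    proof eventually_elim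
      case (elim \<omega>)
      then have "\<xi> \<omega> * min (V \<omega>) (g (W \<omega>)) = min (Y \<omega>) (g (X \<omega>))"
        by (simp add: g_hom min_mult_distrib_left)
      then show ?case by simp
    qed
    show "AE \<omega> in M. 0 \<le> min (fst (V \<omega>, W \<omega>)) (g (snd (V \<omega>, W \<omega>))) \<and>
        min (fst (V \<omega>, W \<omega>)) (g (snd (V \<omega>, W \<omega>))) \<le> t"
      using AE_bounds by eventually_elim (use assms in auto)
  qed (use assms in auto)
  then show ?thesis by simp
qed

text \<open>The quotient of the two tails is eventually the constant \<open>m / mean\<close>, so its
  limit is 1 only if \<open>m = mean\<close>. Since \<open>mean > 0\<close>, the convention for 0/0
  in \<open>asymp_equiv_def\<close> is never invoked for large \<open>t\<close>.\<close>

lemma asymp_calibrated_iff: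
  "asymp_calibrated M Y (\<lambda>\<omega>. g (X \<omega>)) \<longleftrightarrow> expectation (\<lambda>\<omega>. g (W \<omega>)) = mean"
proof -
  define m where "m = expectation (\<lambda>\<omega>. g (W \<omega>))"
  let ?f = "\<lambda>t. \<P>(\<omega> in M. g (X \<omega>) > t)" and ?h = "\<lambda>t. \<P>(\<omega> in M. Y \<omega> > t)"
  have ev: "eventually (\<lambda>t. t \<ge> max 1 B) at_top"
    by (rule eventually_ge_at_top)
  have "(?f \<sim>[at_top] ?h) \<longleftrightarrow> ((\<lambda>_. m / mean) \<longlongrightarrow> 1) (at_top :: real filter)"
    unfolding asymp_equiv_def
  proof (rule tendsto_cong)
    show "eventually (\<lambda>t. (if ?f t = 0 \<and> ?h t = 0 then 1 else ?f t / ?h t) = m / mean) at_top"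
      using ev by eventually_elim
        (use mean_pos in \<open>auto simp: tail_g tail_Y m_def[symmetric]\<close>)
  qed
  also have "\<dots> \<longleftrightarrow> m = mean"
    using mean_pos by (subst tendsto_const_iff) auto
  finally show ?thesis unfolding asymp_calibrated_def m_def .
qed

lemma precision_eq:
  assumes "expectation (\<lambda>\<omega>. g (W \<omega>)) = mean" "1 - mean / max 1 B < p" "p < 1"
  shows "precision M Y (\<lambda>\<omega>. g (X \<omega>)) p = expectation (\<lambda>\<omega>. min (V \<omega>) (g (W \<omega>))) / mean"
  by (rule precision_of_power_tail[where B="max 1 B"])
    (use assms tail_g tail_Y tail_joint mean_pos in auto)

lemma precision_tendsto:
  assumes "expectation (\<lambda>\<omega>. g (W \<omega>)) = mean"
  shows "(precision M Y (\<lambda>\<omega>. g (X \<omega>)) \<longlongrightarrow> expectation (\<lambda>\<omega>. min (V \<omega>) (g (W \<omega>))) / mean) (at_left 1)"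
proof (rule tendsto_eventually)
  have "1 - mean / max 1 B < 1"
    using mean_pos by simp
  from eventually_at_left_real[OF this]
  show "eventually (\<lambda>p. precision M Y (\<lambda>\<omega>. g (X \<omega>)) p =
      expectation (\<lambda>\<omega>. min (V \<omega>) (g (W \<omega>))) / mean) (at_left 1)"
    by eventually_elim (use precision_eq[OF assms] in auto)
qed

text \<open>Both \<open>g\<close> and the 1-norm have degree 1, so their integrals over an event
  determined by the 1-norm are in the fixed ratio of their expectations, \<open>mean\<close> to
  \<open>1 - mean\<close>. Calibration thus makes \<open>g\<close> indistinguishable from the scaled
  1-norm on such events.\<close>

lemma expectation_l1_norm_event:
  assumes Eg: "expectation (\<lambda>\<omega>. g (W \<omega>)) = mean" and A: "A \<in> sets borel"
  shows "expectation (\<lambda>\<omega>. indicator A (l1_norm (W \<omega>)) * g (W \<omega>)) =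
    \<beta>\<^sub>0 / beta_sum * expectation (\<lambda>\<omega>. indicator A (l1_norm (W \<omega>)) * l1_norm (W \<omega>))"
proof -
  have to_real: "(\<integral>\<^sup>+\<omega>. indicator A (l1_norm (W \<omega>)) * ennreal (f (W \<omega>)) \<partial>M) =
      ennreal (expectation (\<lambda>\<omega>. indicator A (l1_norm (W \<omega>)) * f (W \<omega>)))"
    if f [measurable]: "f \<in> borel_measurable borel" "A \<in> sets borel" and f0: "\<And>x. f x \<ge> 0"
      and int: "integrable M (\<lambda>\<omega>. f (W \<omega>))" for A f
  proof -
    have "(\<integral>\<^sup>+\<omega>. indicator A (l1_norm (W \<omega>)) * ennreal (f (W \<omega>)) \<partial>M) =
        (\<integral>\<^sup>+\<omega>. ennreal (indicator A (l1_norm (W \<omega>)) * f (W \<omega>)) \<partial>M)"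
      by (intro nn_integral_cong) (simp add: indicator_def)
    also have "\<dots> = ennreal (expectation (\<lambda>\<omega>. indicator A (l1_norm (W \<omega>)) * f (W \<omega>)))"
    proof (rule nn_integral_eq_integral)
      show "integrable M (\<lambda>\<omega>. indicator A (l1_norm (W \<omega>)) * f (W \<omega>))"
        by (rule Bochner_Integration.integrable_bound[OF int]) (auto simp: indicator_def)
    qed (simp add: f0)
    finally show ?thesis .
  qed
  let ?S = "\<lambda>\<omega>. l1_norm (W \<omega>)" and ?E = "\<lambda>f. expectation (\<lambda>\<omega>. indicator A (l1_norm (W \<omega>)) * f (W \<omega>))"
  have nn: "(\<integral>\<^sup>+\<omega>. ennreal (g (W \<omega>)) \<partial>M) = ennreal mean"
    "(\<integral>\<^sup>+\<omega>. ennreal (l1_norm (W \<omega>)) \<partial>M) = ennreal (1 - mean)"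
    using to_real[OF g, of UNIV] to_real[OF borel_measurable_l1_norm, of UNIV]
    by (simp_all add: g_nonneg integrable_g_W integrable_l1_norm_W Eg expectation_l1_norm)
  have "(\<integral>\<^sup>+\<omega>. indicator A (?S \<omega>) * ennreal (g (W \<omega>)) \<partial>M) * (\<integral>\<^sup>+\<omega>. ennreal (?S \<omega>) \<partial>M) =
    (\<integral>\<^sup>+\<omega>. indicator A (?S \<omega>) * ennreal (?S \<omega>) \<partial>M) * (\<integral>\<^sup>+\<omega>. ennreal (g (W \<omega>)) \<partial>M)"
    by (rule nn_integral_dirichlet_homogeneous_eq[OF W_distributed pos, of _ 1])
      (simp_all add: A borel_measurable_indicator g_nonneg g_hom l1_norm_scaleR nn)
  then have "ennreal (?E g) * ennreal (1 - mean) = ennreal (?E l1_norm) * ennreal mean"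
    by (simp add: nn to_real A g_nonneg integrable_g_W integrable_l1_norm_W)
  moreover have "?E g \<ge> 0" "?E l1_norm \<ge> 0"
    by (simp_all add: g_nonneg integral_nonneg)
  ultimately have "?E g * (1 - mean) = ?E l1_norm * mean"
    using mean_pos mean_less_1 by (simp add: ennreal_mult[symmetric])
  also have "\<dots> = (\<beta>\<^sub>0 / beta_sum * ?E l1_norm) * (1 - mean)"
    by (subst mean_odds) (simp only: mult_ac)
  finally have "?E g * (1 - mean) = (\<beta>\<^sub>0 / beta_sum * ?E l1_norm) * (1 - mean)" .
  moreover have "1 - mean \<noteq> 0" using mean_less_1 by simp
  ultimately show ?thesis
    using mult_right_cancel by blast
qed

text \<open>Since the event \<open>V > c \<parallel>W\<parallel>\<^sub>1\<close> depends on \<open>\<parallel>W\<parallel>\<^sub>1\<close> only, the right-hand side of the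
  supporting-line inequality \<open>V \<and> g(W) \<le> V \<and> c \<parallel>W\<parallel>\<^sub>1 + 1{V > c \<parallel>W\<parallel>\<^sub>1} (g(W) - c \<parallel>W\<parallel>\<^sub>1)\<close>
  has an expectation that does not depend on \<open>g\<close>.\<close>

lemma expectation_min_le:
  assumes Eg: "expectation (\<lambda>\<omega>. g (W \<omega>)) = mean"
  shows "expectation (\<lambda>\<omega>. min (V \<omega>) (g (W \<omega>))) \<le>
    expectation (\<lambda>\<omega>. min (V \<omega>) (\<beta>\<^sub>0 / beta_sum * l1_norm (W \<omega>)))"
proof -
  define c where "c = \<beta>\<^sub>0 / beta_sum"
  have c: "c > 0" using pos(1) beta_sum_pos by (simp add: c_def)
  \<comment> \<open>Since \<open>V\<close> is one minus the 1-norm almost surely, membership of the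
    1-norm in \<open>A\<close> encodes the event that \<open>V\<close> exceeds \<open>c\<close>
    times the 1-norm.\<close>
  define A where "A = {s :: real. c * s < 1 - s}"
  have A [measurable]: "A \<in> sets borel"
    unfolding A_def by measurable
  let ?S = "\<lambda>\<omega>. l1_norm (W \<omega>)" and ?I = "\<lambda>\<omega>. indicator A (l1_norm (W \<omega>)) :: real"
  have int_min: "integrable M (\<lambda>\<omega>. min (V \<omega>) (f \<omega>))"
    if [measurable]: "f \<in> borel_measurable M" and "\<And>\<omega>. f \<omega> \<ge> 0" for f
  proof (rule integrable_of_bounded)
    show "AE \<omega> in M. 0 \<le> min (V \<omega>) (f \<omega>) \<and> min (V \<omega>) (f \<omega>) \<le> 1"
      using AE_bounds by eventually_elim (use that(2) in auto)
  qed measurable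
  have int_I: "integrable M (\<lambda>\<omega>. ?I \<omega> * f (W \<omega>))"
    if [measurable]: "f \<in> borel_measurable borel" and int: "integrable M (\<lambda>\<omega>. f (W \<omega>))" for f
    by (rule Bochner_Integration.integrable_bound[OF int]) (auto simp: indicator_def)
  have ints: "integrable M (\<lambda>\<omega>. min (V \<omega>) (g (W \<omega>)))" "integrable M (\<lambda>\<omega>. min (V \<omega>) (c * ?S \<omega>))"
    "integrable M (\<lambda>\<omega>. ?I \<omega> * g (W \<omega>))" "integrable M (\<lambda>\<omega>. c * (?I \<omega> * ?S \<omega>))"
    using c by (auto intro!: int_min int_I integrable_g_W integrable_l1_norm_W
      Bochner_Integration.integrable_mult_right simp: g_nonneg)
  have "expectation (\<lambda>\<omega>. min (V \<omega>) (g (W \<omega>)) + c * (?I \<omega> * ?S \<omega>)) \<le>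
      expectation (\<lambda>\<omega>. min (V \<omega>) (c * ?S \<omega>) + ?I \<omega> * g (W \<omega>))"
  proof (rule integral_mono_AE)
    \<comment> \<open>On \<open>A\<close> the minimum on the right is
      \<open>c * ?S \<omega>\<close>, which cancels, and the rest is
      \<open>min (V \<omega>) (g (W \<omega>)) \<le> g (W \<omega>)\<close>. Off \<open>A\<close>
      that minimum is \<open>V \<omega>\<close>.\<close>
    show "AE \<omega> in M. min (V \<omega>) (g (W \<omega>)) + c * (?I \<omega> * ?S \<omega>) \<le> min (V \<omega>) (c * ?S \<omega>) + ?I \<omega> * g (W \<omega>)"
      using AE_simplex by eventually_elim (auto simp: A_def indicator_def)
  qed (intro Bochner_Integration.integrable_add ints)+
  then have "expectation (\<lambda>\<omega>. min (V \<omega>) (g (W \<omega>))) + expectation (\<lambda>\<omega>. c * (?I \<omega> * ?S \<omega>)) \<le>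
      expectation (\<lambda>\<omega>. min (V \<omega>) (c * ?S \<omega>)) + expectation (\<lambda>\<omega>. ?I \<omega> * g (W \<omega>))"
    unfolding Bochner_Integration.integral_add[OF ints(1,4)]
      Bochner_Integration.integral_add[OF ints(2,3)] .
  moreover have "expectation (\<lambda>\<omega>. ?I \<omega> * g (W \<omega>)) = expectation (\<lambda>\<omega>. c * (?I \<omega> * ?S \<omega>))"
    using expectation_l1_norm_event[OF Eg A] unfolding c_def by simp
  ultimately show ?thesis
    unfolding c_def[symmetric] by linarith
qed

end

section \<open>The scaled 1-norm as optimal predictor\<close>

definition "precision_opt = expectation (\<lambda>\<omega>. min (V \<omega>) (\<beta>\<^sub>0 / beta_sum * l1_norm (W \<omega>))) / mean"

text \<open>These are the four assumptions on \<open>g\<close> and \<open>B\<close> above, in their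
  order, for the scaled 1-norm with \<open>B = \<beta>\<^sub>0 / beta_sum\<close>. The reflexive
  last item lets a single \<open>OF l1_predictor\<close> discharge them all and fixes
  \<open>B\<close>.\<close>

lemma l1_predictor:
  "(\<lambda>x. \<beta>\<^sub>0 / beta_sum * l1_norm x) \<in> borel_measurable (borel :: (real ^ 'n) measure)"
  "0 \<le> \<beta>\<^sub>0 / beta_sum * l1_norm x"
  "r \<ge> 0 \<Longrightarrow> \<beta>\<^sub>0 / beta_sum * l1_norm (r *\<^sub>R x) = r * (\<beta>\<^sub>0 / beta_sum * l1_norm x)"
  "\<beta>\<^sub>0 / beta_sum * l1_norm x \<le> \<beta>\<^sub>0 / beta_sum * l1_norm x"
  using pos(1) beta_sum_pos by (simp_all add: l1_norm_scaleR)

lemma expectation_l1_predictor: "expectation (\<lambda>\<omega>. \<beta>\<^sub>0 / beta_sum * l1_norm (W \<omega>)) = mean"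
  using mean_odds by (simp add: expectation_l1_norm)

lemma asymp_calibrated_l1_predictor: "asymp_calibrated M Y (\<lambda>\<omega>. \<beta>\<^sub>0 / beta_sum * l1_norm (X \<omega>))"
  using asymp_calibrated_iff[OF l1_predictor] expectation_l1_predictor by simp

lemma l1_predictor_homogeneous: "(\<lambda>x. \<beta>\<^sub>0 / beta_sum * l1_norm x) \<in> homogeneous_predictors M Y X"
proof -
  have "continuous_on UNIV (\<lambda>x :: real ^ 'n. \<beta>\<^sub>0 / beta_sum * l1_norm x)"
    by (intro continuous_intros continuous_on_l1_norm)
  moreover have "bounded ((\<lambda>x :: real ^ 'n. \<beta>\<^sub>0 / beta_sum * l1_norm x) ` {x. l1_norm x = 1})"
    by (rule bounded_subset[of "{\<beta>\<^sub>0 / beta_sum}"]) auto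
  moreover have "{x :: real ^ 'n. \<beta>\<^sub>0 / beta_sum * l1_norm x > 0} \<subseteq> {x. l1_norm x > 0}"
    by auto
  ultimately show ?thesis
    unfolding homogeneous_predictors_def
    using l1_predictor(2,3) asymp_calibrated_l1_predictor by blast
qed

lemma precision_tendsto_l1_predictor:
  "(precision M Y (\<lambda>\<omega>. \<beta>\<^sub>0 / beta_sum * l1_norm (X \<omega>)) \<longlongrightarrow> precision_opt) (at_left 1)"
  unfolding precision_opt_def
  by (rule precision_tendsto[OF l1_predictor expectation_l1_predictor])

text \<open>A bound on the unit sphere of the 1-norm extends to all \<open>x \<noteq> 0\<close> by
  normalizing; at the origin, homogeneity with factor 0 gives \<open>g 0 = 0\<close>.\<close>

lemma homogeneous_predictor_le:
  assumes "g \<in> homogeneous_predictors M Y X"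
  obtains B where "\<And>x. g x \<le> B * l1_norm x"
proof -
  have g_hom: "\<And>c x. c \<ge> 0 \<Longrightarrow> g (c *\<^sub>R x) = c * g x" and "bounded (g ` {x. l1_norm x = 1})"
    using assms unfolding homogeneous_predictors_def by auto
  then obtain B where B: "\<And>x. l1_norm x = 1 \<Longrightarrow> \<bar>g x\<bar> \<le> B"
    unfolding bounded_iff by auto
  have "g x \<le> B * l1_norm x" for x
  proof (cases "x = 0")
    case True
    then show ?thesis using g_hom[of 0 0] by simp
  next
    case False
    then have l: "l1_norm x > 0" by simp
    have "\<bar>g ((1 / l1_norm x) *\<^sub>R x)\<bar> \<le> B"
      using l by (intro B) (simp add: l1_norm_scaleR)
    moreover have "g x = l1_norm x * g ((1 / l1_norm x) *\<^sub>R x)"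
      using l g_hom[of "l1_norm x" "(1 / l1_norm x) *\<^sub>R x"] by simp
    ultimately show ?thesis
      using l mult_left_mono[of "g ((1 / l1_norm x) *\<^sub>R x)" B "l1_norm x"] by (simp add: mult.commute)
  qed
  then show ?thesis by (rule that)
qed

text \<open>For every admissible \<open>g\<close> the upper limit is a genuine limit, and
  calibration makes \<open>expectation_min_le\<close> applicable. The bound is attained by the
  scaled 1-norm, itself a member of the class.\<close>

lemma opt_precision_eq: "opt_precision M Y X = ereal precision_opt"
proof (rule antisym)
  show "opt_precision M Y X \<le> ereal precision_opt"
    unfolding opt_precision_def
  proof (rule SUP_least)
    fix g assume G: "g \<in> homogeneous_predictors M Y X"
    obtain B where B: "\<And>x. g x \<le> B * l1_norm x"
      using homogeneous_predictor_le[OF G] by blast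
    have g: "g \<in> borel_measurable borel" "\<And>x. 0 \<le> g x" "\<And>c x. c \<ge> 0 \<Longrightarrow> g (c *\<^sub>R x) = c * g x"
      "asymp_calibrated M Y (\<lambda>\<omega>. g (X \<omega>))"
      using G unfolding homogeneous_predictors_def by (auto intro: borel_measurable_continuous_onI)
    have Eg: "expectation (\<lambda>\<omega>. g (W \<omega>)) = mean"
      using asymp_calibrated_iff[OF g(1,2,3) B] g(4) by simp
    have "((\<lambda>p. ereal (precision M Y (\<lambda>\<omega>. g (X \<omega>)) p)) \<longlongrightarrow>
        ereal (expectation (\<lambda>\<omega>. min (V \<omega>) (g (W \<omega>))) / mean)) (at_left 1)"
      by (intro tendsto_intros precision_tendsto[OF g(1,2,3) B Eg])
    then have "Limsup (at_left 1) (\<lambda>p. ereal (precision M Y (\<lambda>\<omega>. g (X \<omega>)) p)) =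
        ereal (expectation (\<lambda>\<omega>. min (V \<omega>) (g (W \<omega>))) / mean)"
      by (intro lim_imp_Limsup) auto
    also have "\<dots> \<le> ereal precision_opt"
      using expectation_min_le[OF g(1,2,3) B Eg] mean_pos
      unfolding precision_opt_def by (simp add: divide_right_mono)
    finally show "Limsup (at_left 1) (\<lambda>p. ereal (precision M Y (\<lambda>\<omega>. g (X \<omega>)) p)) \<le> ereal precision_opt" .
  qed
  have "ereal precision_opt =
      Limsup (at_left 1) (\<lambda>p. ereal (precision M Y (\<lambda>\<omega>. \<beta>\<^sub>0 / beta_sum * l1_norm (X \<omega>)) p))"
    by (intro lim_imp_Limsup[symmetric] tendsto_intros precision_tendsto_l1_predictor) auto
  also have "\<dots> \<le> opt_precision M Y X"
    unfolding opt_precision_def by (rule SUP_upper[OF l1_predictor_homogeneous])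
  finally show "ereal precision_opt \<le> opt_precision M Y X" .
qed

lemma asymp_precision_l1_predictor:
  "asymp_precision M Y (\<lambda>\<omega>. \<beta>\<^sub>0 / beta_sum * l1_norm (X \<omega>)) = precision_opt"
  unfolding asymp_precision_def by (intro tendsto_Lim precision_tendsto_l1_predictor) auto

section \<open>Beta form of the optimal value and the threshold level\<close>

lemma precision_opt_beta:
  "precision_opt = (\<integral>u. min (u / mean) ((1 - u) / (1 - mean)) \<partial>beta_law \<beta>\<^sub>0 beta_sum)"
proof -
  have c: "\<beta>\<^sub>0 / beta_sum = mean / (1 - mean)"
    using mean_odds mean_less_1 by (simp add: field_simps)
  have "(\<integral>u. min (u / mean) ((1 - u) / (1 - mean)) \<partial>beta_law \<beta>\<^sub>0 beta_sum) =
      expectation (\<lambda>\<omega>. min (V \<omega> / mean) ((1 - V \<omega>) / (1 - mean)))"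
    unfolding V_law[symmetric] by (subst integral_distr) auto
  also have "\<dots> = expectation (\<lambda>\<omega>. min (V \<omega>) (\<beta>\<^sub>0 / beta_sum * l1_norm (W \<omega>)) / mean)"
  proof (rule integral_cong_AE)
    \<comment> \<open>Dividing by \<open>mean\<close> turns the factor
      \<open>mean / (1 - mean)\<close> of the 1-norm into \<open>1 / (1 - mean)\<close>, and the
      1-norm of \<open>W\<close> is \<open>1 - V \<omega>\<close>.\<close>
    show "AE \<omega> in M. min (V \<omega> / mean) ((1 - V \<omega>) / (1 - mean)) =
        min (V \<omega>) (\<beta>\<^sub>0 / beta_sum * l1_norm (W \<omega>)) / mean"
      using AE_simplex by eventually_elim
        (use mean_pos in \<open>simp add: c min_divide_distrib_right\<close>)
  qed measurable
  also have "\<dots> = precision_opt"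
    unfolding precision_opt_def by simp
  finally show ?thesis by simp
qed

text \<open>The first identity recognizes the stated threshold as the bound on \<open>p\<close> in
  \<open>precision_eq\<close> for \<open>B = \<beta>\<^sub>0 / beta_sum\<close>; the second
  expresses it by the mean. Both follow from \<open>mean = c / (c + 1)\<close> by comparing
  \<open>c\<close> with 1.\<close>

lemma threshold_eq:
  "max 1 (\<beta>\<^sub>0 / beta_sum) / (\<beta>\<^sub>0 / beta_sum + 1) = 1 - mean / max 1 (\<beta>\<^sub>0 / beta_sum)"
  "max 1 (\<beta>\<^sub>0 / beta_sum) / (\<beta>\<^sub>0 / beta_sum + 1) = max mean (1 - mean)"
proof -
  define c where "c = \<beta>\<^sub>0 / beta_sum"
  have c: "c > 0" using pos(1) beta_sum_pos by (simp add: c_def)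
  have m: "mean = c / (c + 1)" "1 - mean = 1 / (c + 1)"
    using pos(1) beta_sum_pos by (simp_all add: mean_def c_def field_simps)
  have "max 1 c / (c + 1) = 1 - mean / max 1 c \<and> max 1 c / (c + 1) = max mean (1 - mean)"
  proof (cases "c \<le> 1")
    case True
    then have "mean \<le> 1 - mean" unfolding m using c by (simp add: divide_right_mono)
    then show ?thesis using True m by simp
  next
    case False
    then have "1 - mean \<le> mean" unfolding m using c by (simp add: divide_right_mono)
    then have "max mean (1 - mean) = mean" by simp
    moreover have "mean / c = 1 / (c + 1)" unfolding m(1) using c by simp
    moreover have "max 1 c = c" using False by simp
    ultimately show ?thesis using m by linarith
  qed
  then show "max 1 (\<beta>\<^sub>0 / beta_sum) / (\<beta>\<^sub>0 / beta_sum + 1) = 1 - mean / max 1 (\<beta>\<^sub>0 / beta_sum)"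
    "max 1 (\<beta>\<^sub>0 / beta_sum) / (\<beta>\<^sub>0 / beta_sum + 1) = max mean (1 - mean)"
    unfolding c_def by auto
qed

lemma precision_l1_predictor:
  assumes "max 1 (\<beta>\<^sub>0 / beta_sum) / (\<beta>\<^sub>0 / beta_sum + 1) < p" "p < 1"
  shows "precision M Y (\<lambda>\<omega>. \<beta>\<^sub>0 / beta_sum * l1_norm (X \<omega>)) p = precision_opt"
  unfolding precision_opt_def
  by (rule precision_eq[OF l1_predictor expectation_l1_predictor])
    (use assms threshold_eq(1) in auto)

end

theorem propositionC3:
  fixes M :: "'w measure" and Y :: "'w \<Rightarrow> real" and X :: "'w \<Rightarrow> real ^ 'n"
    and \<beta>\<^sub>0 :: real and \<beta> :: "real ^ 'n"
    and c \<mu> p\<^sub>0 :: real and h :: "real ^ 'n \<Rightarrow> real"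
  assumes "prob_space M"
    and "\<beta>\<^sub>0 > 0" and "\<And>i. \<beta> $ i > 0"
    and "pareto_dirichlet M \<beta>\<^sub>0 \<beta> Y X"
  defines "c \<equiv> \<beta>\<^sub>0 / (\<Sum>i\<in>UNIV. \<beta> $ i)"
    and "h \<equiv> \<lambda>x. c * l1_norm x"
    and "\<mu> \<equiv> (\<integral>u. u \<partial>beta_law \<beta>\<^sub>0 (\<Sum>i\<in>UNIV. \<beta> $ i))"
    and "p\<^sub>0 \<equiv> max 1 c / (c + 1)"
  shows "(asymp_calibrated M Y (\<lambda>\<omega>. h (X \<omega>)) \<and> optimal_predictor M Y X h) \<and>
         (opt_precision M Y X = ereal (asymp_precision M Y (\<lambda>\<omega>. h (X \<omega>))) \<and>
         asymp_precision M Y (\<lambda>\<omega>. h (X \<omega>)) =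
           (\<integral>u. min (u / \<mu>) ((1 - u) / (1 - \<mu>)) \<partial>beta_law \<beta>\<^sub>0 (\<Sum>i\<in>UNIV. \<beta> $ i)) \<and>
         \<mu> = \<beta>\<^sub>0 / (\<beta>\<^sub>0 + (\<Sum>i\<in>UNIV. \<beta> $ i))) \<and>
         ((\<forall>p\<in>{p\<^sub>0<..<1}. opt_precision M Y X = ereal (precision M Y (\<lambda>\<omega>. h (X \<omega>)) p)) \<and>
         p\<^sub>0 = max \<mu> (1 - \<mu>))"
proof -
  \<comment> \<open>Naming the witnesses turns the hypotheses into those of the locale, where every
    claim is already available.\<close>
  obtain \<xi> V W where "pareto_dirichlet_representation M \<beta>\<^sub>0 \<beta> Y X \<xi> V W"
    using assms(1-4) unfolding pareto_dirichlet_def pareto_dirichlet_representation_def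
      pareto_dirichlet_representation_axioms_def by auto
  then interpret pareto_dirichlet_representation M \<beta>\<^sub>0 \<beta> Y X \<xi> V W .
  have c: "c = \<beta>\<^sub>0 / beta_sum"
    unfolding c_def beta_sum_def ..
  have h: "h = (\<lambda>x. \<beta>\<^sub>0 / beta_sum * l1_norm x)"
    unfolding h_def c ..
  have mu: "\<mu> = mean"
    unfolding \<mu>_def mean_def beta_sum_def[symmetric] using integral_beta_law_id[OF pos(1) beta_sum_pos] .
  have "optimal_predictor M Y X (\<lambda>x. \<beta>\<^sub>0 / beta_sum * l1_norm x)"
    unfolding optimal_predictor_def asymp_precision_exists_def asymp_precision_l1_predictor opt_precision_eq
    using l1_predictor_homogeneous precision_tendsto_l1_predictor by blast
  then show ?thesis
    unfolding mu p\<^sub>0_def c h beta_sum_def[symmetric] asymp_precision_l1_predictor opt_precision_eq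
    using asymp_calibrated_l1_predictor precision_l1_predictor threshold_eq(2) precision_opt_beta mean_def
    by (intro conjI ballI) (simp_all only: greaterThanLessThan_iff)
qed

end
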